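(* Let $\mathcal{A}$ be a unital $C^*$-algebra and let $D\in B^a(H_{\mathcal{A}})$. Then $$\sigma_{e\tilde d}^{\mathcal{A}}(D)=\bigcap\{\,\sigma_d^{\mathcal{A}}(PD_{|R(P)}) \mid P\in \mathrm{P}^a(H_{\mathcal{A}})\,\},$$ where $\sigma_{e\tilde d}^{\mathcal{A}}(D)=\{\alpha\in Z(\mathcal{A}) \mid D-\alpha I\notin\widehat{\mathcal{M}\Phi}_-^+(H_{\mathcal{A}})\}$ and, for $P\in \mathrm{P}^a(H_{\mathcal{A}})$, $$\sigma_d^{\mathcal{A}}(PD_{|R(P)})=\{\alpha\in Z(\mathcal{A}) \mid (PD-\alpha I)_{|R(P)} \text{ is not onto } R(P)\}.$$
   Context: $\mathcal{A}$ is a unital $C^*$-algebra with center $Z(\mathcal{A})$; $H_{\mathcal{A}}$ is the standard countably generated (right) Hilbert $\mathcal{A}$-module. $B^a(H_{\mathcal{A}})$ is the set of bounded adjointable operators on $H_{\mathcal{A}}$. For $\alpha\in Z(\mathcal{A})$, $\alpha I$ is the operator $x\mapsto x\alpha$ (it maps $R(P)$ into $R(P)$ for every $\mathcal{A}$-linear idempotent $P$). $R(T)$ and $N(T)$ denote image and kernel of $T$. $\tilde\oplus$ denotes the internal direct sum of closed submodules, not necessarily orthogonal. A Hilbert module is finitely generated if it equals the $\mathcal{A}$-linear span of a finite subset. "Isomorphism" between closed submodules means a bounded bijective $\mathcal{A}$-linear map (with bounded inverse). "Projection" means a not necessarily orthogonal (skew) projection, i.e. an idempotent. $\mathrm{P}^a(H_{\mathcal{A}})=\{P\in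 B^a(H_{\mathcal{A}}) \mid P \text{ is a projection and } N(P) \text{ is finitely generated}\}$. "$D$ has matrix $\begin{bmatrix}D_1&0\\0&D_4\end{bmatrix}$ with respect to the decomposition $H_{\mathcal{A}}=M_1'\tilde\oplus N_1'\stackrel{D}{\longrightarrow}M_2'\tilde\oplus N_2'=H_{\mathcal{A}}$" means that $D(M_1')\subseteq M_2'$, $D(N_1')\subseteq N_2'$, $D_1=D_{|M_1'}:M_1'\to M_2'$ and $D_4=D_{|N_1'}:N_1'\to N_2'$; here all four submodules are closed. $\widehat{\mathcal{M}\Phi}_-^+(H_{\mathcal{A}})$ is the set of all $D\in B^a(H_{\mathcal{A}})$ for which there is a decomposition $H_{\mathcal{A}}=M_1'\tilde\oplus N_1'\stackrel{D}{\longrightarrow}M_2'\tilde\oplus N_2'=H_{\mathcal{A}}$ with respect to which $D$ has matrix $\begin{bmatrix}D_1&0\\0&D_4\end{bmatrix}$, where $D_1$ is an isomorphism, $N_2'$ is finitely generated, and $H_{\mathcal{A}}=M_1'\tilde\oplus N\tilde\oplus N_2'$ for some closed submodule $N$, where the projection onto $M_1'\tilde\oplus N$ along $N_2'$ is adjointable. *)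

theory Defs
  imports "HOL-Analysis.Analysis" "HOL-Library.Function_Algebras"
begin

section \<open>Unital \<open>C\<^sup>*\<close>-algebras\<close>

text \<open>The real scalar multiplication and the norm come from \<open>real_normed_algebra_1\<close>
  (so \<open>1 \<noteq> 0\<close> and \<open>norm 1 = 1\<close>), completeness from \<open>banach\<close>.\<close>

class unital_cstar_algebra = real_normed_algebra_1 + banach +
  fixes scaleC :: "complex \<Rightarrow> 'a \<Rightarrow> 'a"
    and star :: "'a \<Rightarrow> 'a"
  assumes scaleR_scaleC: "scaleR r x = scaleC (complex_of_real r) x"
    and scaleC_add_right: "scaleC c (x + y) = scaleC c x + scaleC c y"
    and scaleC_add_left: "scaleC (c + d) x = scaleC c x + scaleC d x"
    and scaleC_scaleC: "scaleC c (scaleC d x) = scaleC (c * d) x"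
    and scaleC_one: "scaleC 1 x = x"
    and mult_scaleC_left: "scaleC c x * y = scaleC c (x * y)"
    and mult_scaleC_right: "x * scaleC c y = scaleC c (x * y)"
    and norm_scaleC: "norm (scaleC c x) = cmod c * norm x"
    and star_add: "star (x + y) = star x + star y"
    and star_scaleC: "star (scaleC c x) = scaleC (cnj c) (star x)"
    and star_mult: "star (x * y) = star y * star x"
    and star_star: "star (star x) = x"
    and cstar_identity: "norm (star x * x) = (norm x)\<^sup>2"

definition center :: "'a::unital_cstar_algebra set" where
  "center = {\<alpha>. \<forall>a. \<alpha> * a = a * \<alpha>}"

section \<open>The standard Hilbert module\<close>

text \<open>Elements are sequences in the algebra, with the pointwise addition of
  \<open>Function_Algebras\<close>; all notions below are relative to the carrier \<open>hmod\<close>.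
  As the algebra is unital, complex scalar multiples are right multiples by
  \<open>scaleC c 1\<close>, so that submodules are complex subspaces and module maps are complex linear.\<close>

definition hmod :: "(nat \<Rightarrow> 'a::unital_cstar_algebra) set" where
  "hmod = {x. summable (\<lambda>k. star (x k) * x k)}"

definition hinner :: "(nat \<Rightarrow> 'a::unital_cstar_algebra) \<Rightarrow> (nat \<Rightarrow> 'a) \<Rightarrow> 'a" where
  "hinner x y = (\<Sum>k. star (x k) * y k)"

definition hnorm :: "(nat \<Rightarrow> 'a::unital_cstar_algebra) \<Rightarrow> real" where
  "hnorm x = sqrt (norm (hinner x x))"

definition hmod_topology :: "(nat \<Rightarrow> 'a::unital_cstar_algebra) topology" where
  "hmod_topology = Metric_space.mtopology hmod (\<lambda>x y. hnorm (x - y))"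

definition ract :: "(nat \<Rightarrow> 'a::unital_cstar_algebra) \<Rightarrow> 'a \<Rightarrow> (nat \<Rightarrow> 'a)"  (infixl "\<odot>" 75)
  where "x \<odot> a = (\<lambda>k. x k * a)"

definition closed_submodule :: "(nat \<Rightarrow> 'a::unital_cstar_algebra) set \<Rightarrow> bool" where
  "closed_submodule M \<longleftrightarrow>
     M \<subseteq> hmod \<and> 0 \<in> M \<and> (\<forall>x\<in>M. \<forall>y\<in>M. x + y \<in> M) \<and> (\<forall>x\<in>M. \<forall>a. x \<odot> a \<in> M) \<and>
     closedin hmod_topology M"

definition finitely_generated :: "(nat \<Rightarrow> 'a::unital_cstar_algebra) set \<Rightarrow> bool" where
  "finitely_generated M \<longleftrightarrow>
     (\<exists>F. finite F \<and> F \<subseteq> M \<and> M = {(\<Sum>f\<in>F. f \<odot> c f) | c. True})"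

definition msum :: "(nat \<Rightarrow> 'a::unital_cstar_algebra) set \<Rightarrow> (nat \<Rightarrow> 'a) set \<Rightarrow> (nat \<Rightarrow> 'a) set" where
  "msum M N = {m + n | m n. m \<in> M \<and> n \<in> N}"

text \<open>\<open>dsum X M N\<close> says that \<open>X\<close> is the internal, not necessarily orthogonal, direct sum of
  the closed submodules \<open>M\<close> and \<open>N\<close>.\<close>

definition dsum ::
  "(nat \<Rightarrow> 'a::unital_cstar_algebra) set \<Rightarrow> (nat \<Rightarrow> 'a) set \<Rightarrow> (nat \<Rightarrow> 'a) set \<Rightarrow> bool" where
  "dsum X M N \<longleftrightarrow>
     closed_submodule M \<and> closed_submodule N \<and> M \<inter> N = {0} \<and> X = msum M N"

section \<open>Operators\<close>

text \<open>Operators are total functions on sequences; only their values on \<open>hmod\<close> matter.\<close>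

definition module_linear_on ::
  "(nat \<Rightarrow> 'a::unital_cstar_algebra) set \<Rightarrow> ((nat \<Rightarrow> 'a) \<Rightarrow> nat \<Rightarrow> 'a) \<Rightarrow> bool" where
  "module_linear_on M T \<longleftrightarrow>
     (\<forall>x\<in>M. \<forall>y\<in>M. T (x + y) = T x + T y) \<and> (\<forall>x\<in>M. \<forall>a. T (x \<odot> a) = T x \<odot> a)"

definition bounded_on ::
  "(nat \<Rightarrow> 'a::unital_cstar_algebra) set \<Rightarrow> ((nat \<Rightarrow> 'a) \<Rightarrow> nat \<Rightarrow> 'a) \<Rightarrow> bool" where
  "bounded_on M T \<longleftrightarrow> (\<exists>C. \<forall>x\<in>M. hnorm (T x) \<le> C * hnorm x)"

definition Ba :: "((nat \<Rightarrow> 'a::unital_cstar_algebra) \<Rightarrow> nat \<Rightarrow> 'a) set" where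
  "Ba = {T. T ` hmod \<subseteq> hmod \<and> module_linear_on hmod T \<and> bounded_on hmod T \<and>
     (\<exists>S. S ` hmod \<subseteq> hmod \<and> (\<forall>x\<in>hmod. \<forall>y\<in>hmod. hinner (T x) y = hinner x (S y)))}"

definition op_range ::
  "((nat \<Rightarrow> 'a::unital_cstar_algebra) \<Rightarrow> nat \<Rightarrow> 'a) \<Rightarrow> (nat \<Rightarrow> 'a) set" where
  "op_range T = T ` hmod"

definition op_kernel ::
  "((nat \<Rightarrow> 'a::unital_cstar_algebra) \<Rightarrow> nat \<Rightarrow> 'a) \<Rightarrow> (nat \<Rightarrow> 'a) set" where
  "op_kernel T = {x \<in> hmod. T x = 0}"

definition Pa :: "((nat \<Rightarrow> 'a::unital_cstar_algebra) \<Rightarrow> nat \<Rightarrow> 'a) set" where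
  "Pa = {P \<in> Ba. (\<forall>x\<in>hmod. P (P x) = P x) \<and> finitely_generated (op_kernel P)}"

definition module_iso ::
  "(nat \<Rightarrow> 'a::unital_cstar_algebra) set \<Rightarrow> (nat \<Rightarrow> 'a) set \<Rightarrow>
    ((nat \<Rightarrow> 'a) \<Rightarrow> nat \<Rightarrow> 'a) \<Rightarrow> bool" where
  "module_iso M N T \<longleftrightarrow>
     bij_betw T M N \<and> module_linear_on M T \<and> bounded_on M T \<and> bounded_on N (inv_into M T)"

text \<open>The projection onto \<open>M\<close> along \<open>N\<close>; meaningful on \<open>hmod\<close> when \<open>dsum hmod M N\<close>.\<close>

definition proj_along ::
  "(nat \<Rightarrow> 'a::unital_cstar_algebra) set \<Rightarrow> (nat \<Rightarrow> 'a) set \<Rightarrow> (nat \<Rightarrow> 'a) \<Rightarrow> nat \<Rightarrow> 'a" where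
  "proj_along M N x = (THE m. m \<in> M \<and> (\<exists>n\<in>N. x = m + n))"

text \<open>The threefold sum of \<open>M1\<close>, \<open>N\<close> and \<open>N2\<close> is bracketed as
  \<open>(M1 + N) + N2\<close>. That \<open>M1 + N\<close> is closed, as \<open>dsum\<close> then demands, is no restriction: by the
  open mapping theorem it holds in any algebraic direct sum decomposition of \<open>hmod\<close> into three
  closed submodules.\<close>

definition MPhi_minus_plus_hat :: "((nat \<Rightarrow> 'a::unital_cstar_algebra) \<Rightarrow> nat \<Rightarrow> 'a) set" where
  "MPhi_minus_plus_hat = {D \<in> Ba. \<exists>M1 N1 M2 N2.
     dsum hmod M1 N1 \<and> dsum hmod M2 N2 \<and>
     D ` M1 \<subseteq> M2 \<and> D ` N1 \<subseteq> N2 \<and>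
     module_iso M1 M2 D \<and> finitely_generated N2 \<and>
     (\<exists>N. dsum (msum M1 N) M1 N \<and> dsum hmod (msum M1 N) N2 \<and>
          proj_along (msum M1 N) N2 \<in> Ba)}"

section \<open>Spectra\<close>

definition sigma_ed_tilde ::
  "((nat \<Rightarrow> 'a::unital_cstar_algebra) \<Rightarrow> nat \<Rightarrow> 'a) \<Rightarrow> 'a set" where
  "sigma_ed_tilde D = {\<alpha> \<in> center. (\<lambda>x. D x - x \<odot> \<alpha>) \<notin> MPhi_minus_plus_hat}"

text \<open>\<open>sigma_d M T\<close> is the defect spectrum of the restriction of \<open>T\<close> to an operator on \<open>M\<close>.\<close>

definition sigma_d ::
  "(nat \<Rightarrow> 'a::unital_cstar_algebra) set \<Rightarrow> ((nat \<Rightarrow> 'a) \<Rightarrow> nat \<Rightarrow> 'a) \<Rightarrow> 'a set" where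
  "sigma_d M T = {\<alpha> \<in> center. (\<lambda>x. T x - x \<odot> \<alpha>) ` M \<noteq> M}"

end

theory Submission
  imports Defs
begin

text \<open>
  Fix \<open>\<alpha>\<close> in the center and put \<open>T = D - \<alpha> I\<close>, again adjointable. On the range \<open>M\<close> of an adjointable
  idempotent \<open>P\<close> the operators \<open>P D - \<alpha> I\<close> and \<open>P T\<close> agree. So the theorem says that \<open>T\<close> has a decomposition
  of the required kind if and only if \<open>P T\<close> maps \<open>M\<close> onto \<open>M\<close> for some \<open>P\<close> with finitely generated kernel.

  If \<open>T\<close> has such a decomposition, let \<open>P\<close> be the adjointable projection onto \<open>M1 + N\<close> along \<open>N2\<close>. Then
  \<open>P (T M1) = P M2 = P (M2 + N2)\<close> is the whole range of \<open>P\<close> (\<open>compression_surjective_of_MPhi\<close>).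

  Conversely, if \<open>P T\<close> is onto \<open>M\<close>, then \<open>S = P T P + (1 - P)\<close> is onto the whole module. The essential
  fact is that a surjective adjointable operator has a bounded right inverse that is linear over the
  algebra (\<open>surjective_right_inverse\<close>). A right inverse \<open>R\<close> of \<open>S\<close> satisfies \<open>P T R = 1\<close> on \<open>M\<close>, so \<open>R P T\<close> and
  \<open>T R P\<close> are bounded idempotents, and their ranges and kernels form the decomposition
  (\<open>MPhi_of_compression_surjective\<close>).

  The right inverse of a surjective \<open>T\<close> with adjoint \<open>S\<close> is \<open>S\<close> composed with the inverse of \<open>Q = T S\<close>. By
  uniform boundedness \<open>S\<close> is bounded below. This passes to all \<open>Q + s\<close> with \<open>s \<ge> 0\<close>, with one constant,
  because adding a positive element to a positive element does not decrease the norm; and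
  such a uniform lower bound allows solvability to be carried from large \<open>s\<close>, where it is clear, down to
  \<open>s = 0\<close> (\<open>coercive_surjective\<close>).

  Monotonicity of the norm is also behind the Cauchy--Schwarz inequality, without which not even
  closure of the standard module under addition is clear. The order of a \<open>C\<^sup>*\<close>-algebra is therefore
  built first, without spectral theory: positivity is the condition \<open>norm (t - h) \<le> t\<close>, square roots come
  from an iteration, norm estimates from the fact that commuting self-adjoint \<open>x\<close>, \<open>y\<close> with
  \<open>x\<^sup>2 + y\<^sup>2 = r\<^sup>2\<close> have norm at most \<open>r\<close> (\<open>commuting_circle_bound\<close>), and the positivity of \<open>star a * a\<close>
  from a growth argument (\<open>star_square_negative_zero\<close>).
\<close>


section \<open>The involution\<close>

lemma star_zero: "star (0::'a::unital_cstar_algebra) = 0"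
  using star_add[of "0::'a" 0] by simp

lemma star_uminus: "star (- x) = - star (x::'a::unital_cstar_algebra)"
  using star_add[of x "-x"] by (simp add: star_zero eq_neg_iff_add_eq_0 add.commute)

lemma star_diff: "star (x - y) = star x - star (y::'a::unital_cstar_algebra)"
  using star_add[of x "-y"] by (simp add: star_uminus)

lemma star_one: "star (1::'a::unital_cstar_algebra) = 1"
  using star_mult[of "star 1" "1::'a"] by (simp add: star_star)

lemma star_scaleR: "star (r *\<^sub>R x) = r *\<^sub>R star (x::'a::unital_cstar_algebra)"
  by (simp add: scaleR_scaleC star_scaleC)

lemma star_of_real: "star (of_real r :: 'a::unital_cstar_algebra) = of_real r"
  by (simp add: of_real_def star_scaleR star_one)

lemma star_sum: "star (sum f I) = (\<Sum>k\<in>I. star (f k :: 'a::unital_cstar_algebra))"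
  by (induction I rule: infinite_finite_induct) (auto simp: star_zero star_add)

lemma norm_star: "norm (star x) = norm (x::'a::unital_cstar_algebra)"
proof -
  have le: "norm y \<le> norm (star y)" for y :: 'a
  proof (cases "y = 0")
    case False
    have "norm y * norm y \<le> norm (star y) * norm y"
      using cstar_identity[of y] norm_mult_ineq[of "star y" y] by (simp add: power2_eq_square)
    then show ?thesis using False by simp
  qed simp
  show ?thesis using le[of x] le[of "star x"] by (simp add: star_star)
qed

lemma bounded_linear_star: "bounded_linear (star :: 'a::unital_cstar_algebra \<Rightarrow> 'a)"
  by (rule bounded_linear_intro[of _ 1]) (auto simp: star_add star_scaleR norm_star)

lemmas tendsto_star = bounded_linear.tendsto[OF bounded_linear_star]

lemma norm_self_square:
  "star x = x \<Longrightarrow> norm (x * x) = (norm (x::'a::unital_cstar_algebra))\<^sup>2"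
  using cstar_identity[of x] by simp

lemma self_square_zero: "star x = x \<Longrightarrow> x * x = 0 \<Longrightarrow> x = (0::'a::unital_cstar_algebra)"
  using norm_self_square[of x] by simp

section \<open>Positive elements\<close>

text \<open>For self-adjoint \<open>h\<close> the norm condition says that the spectrum of \<open>h\<close> lies in a disc about some
  \<open>t\<close> of radius \<open>t\<close>, hence in the nonnegative half line. Expressed through the norm, positivity is
  at once seen to be additive and to produce square roots by a convergent iteration.\<close>

definition cstar_positive :: "'a::unital_cstar_algebra \<Rightarrow> bool" where
  "cstar_positive h \<longleftrightarrow> star h = h \<and> (\<exists>t. norm (of_real t - h) \<le> t)"

lemma positive_self: "cstar_positive h \<Longrightarrow> star h = h"
  by (simp add: cstar_positive_def)

lemma positiveI: "star h = h \<Longrightarrow> norm (of_real t - h) \<le> t \<Longrightarrow> cstar_positive h"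
  by (auto simp: cstar_positive_def)

text \<open>The element \<open>v = x + \<i> y\<close> satisfies \<open>star v * v = x\<^sup>2 + y\<^sup>2\<close> because \<open>x\<close> and \<open>y\<close> commute,
  so the \<open>C\<^sup>*\<close>-identity gives \<open>norm v = r\<close>, and \<open>x\<close> is the mean of \<open>v\<close> and \<open>star v\<close>.
  All norm estimates for positive elements below come from this bound.\<close>

lemma commuting_circle_bound:
  fixes x y :: "'a::unital_cstar_algebra"
  assumes "star x = x" "star y = y" "x * y = y * x" "x * x + y * y = of_real (r\<^sup>2)" "0 \<le> r"
  shows "norm x \<le> r"
proof -
  define v where "v = x + scaleC \<i> y"
  have sv: "star v = x + scaleC (-\<i>) y"
    by (simp add: v_def star_add star_scaleC assms)
  have iy: "scaleC (-\<i>) z + scaleC \<i> z = 0" for z :: 'a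
    using scaleC_add_left[of "-\<i>" \<i> z] scaleR_scaleC[of 0 z] by simp
  have neg: "scaleC (-\<i>) z = - scaleC \<i> z" for z :: 'a
    using iy by (simp add: eq_neg_iff_add_eq_0)
  have neg1: "scaleC (- 1) z = - z" for z :: 'a
    using scaleR_scaleC[of "-1" z] by simp
  have diffC: "scaleC c (z - w) = scaleC c z - scaleC c w" for c and z w :: 'a
    using scaleC_add_right[of c "z - w" w] by (simp add: algebra_simps)
  have "star v * v = x * x + y * y
      + (scaleC \<i> (x * y) + scaleC (-\<i>) (y * x))"
    unfolding sv unfolding v_def
    by (simp add: algebra_simps mult_scaleC_left mult_scaleC_right scaleC_add_right diffC scaleC_scaleC scaleC_one neg neg1)
  also have "\<dots> = of_real (r\<^sup>2)"
    using assms(3,4) iy[of "y * x"] by (simp add: add.commute scaleC_one)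
  finally have "(norm v)\<^sup>2 = r\<^sup>2"
    by (metis cstar_identity norm_of_real abs_power2)
  then have nv: "norm v = r" using assms(5) by simp
  have "v + star v = 2 *\<^sub>R x"
    unfolding sv unfolding v_def neg by (simp add: scaleR_2)
  then have "2 * norm x \<le> norm v + norm (star v)"
    using norm_triangle_ineq[of v "star v"] by simp
  then show ?thesis by (simp add: norm_star nv)
qed

text \<open>The fixed point of \<open>y \<mapsto> (x + y\<^sup>2) / 2\<close> is \<open>1 - sqrt (1 - x)\<close>. Its iterates from 0 are dominated, as
  are their increments, by the same iteration for the number \<open>x = 1\<close>, which increases and stays
  below 1. As a limit of polynomials in \<open>x\<close>, the fixed point commutes with everything that commutes
  with \<open>x\<close>.\<close>

lemma sqrt_one_minus:
  fixes x :: "'a::unital_cstar_algebra"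
  assumes x: "norm x \<le> 1" "star x = x"
  obtains y where "norm y \<le> 1" "star y = y" "(1 - y) * (1 - y) = 1 - x"
    "\<And>c. c * x = x * c \<Longrightarrow> c * y = y * c"
proof -
  define Y where "Y = rec_nat (0::'a) (\<lambda>_ y. (1/2) *\<^sub>R (x + y * y))"
  define r where "r = rec_nat (0::real) (\<lambda>_ y. (1/2) * (1 + y * y))"
  have Y0: "Y 0 = 0" and YS: "Y (Suc n) = (1/2) *\<^sub>R (x + Y n * Y n)" for n
    by (simp_all add: Y_def)
  have r0: "r 0 = 0" and rS: "r (Suc n) = (1/2) * (1 + r n * r n)" for n
    by (simp_all add: r_def)
  have rb: "0 \<le> r n \<and> r n \<le> 1" for n
  proof (induction n)
    case (Suc n)
    then have "r n * r n \<le> 1 * 1" by (intro mult_mono) auto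
    then show ?case by (simp add: rS)
  qed (simp add: r0)
  have Yr: "norm (Y n) \<le> r n" for n
  proof (induction n)
    case (Suc n)
    have "norm (Y n * Y n) \<le> r n * r n"
      by (rule order_trans[OF norm_mult_ineq]) (intro mult_mono Suc norm_ge_zero; use rb in auto)
    then have "norm (x + Y n * Y n) \<le> 1 + r n * r n"
      using norm_triangle_ineq[of x "Y n * Y n"] x by linarith
    then show ?case by (simp add: YS rS)
  qed (simp add: Y0 r0)
  have comm: "c * Y n = Y n * c" if "c * x = x * c" for c n
  proof (induction n)
    case (Suc n)
    have "c * (Y n * Y n) = (Y n * Y n) * c"
      by (metis Suc mult.assoc)
    then show ?case using that by (simp add: YS algebra_simps)
  qed (simp add: Y0)
  have Ycomm: "Y m * Y n = Y n * Y m" for m n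
    by (rule comm, rule comm[symmetric], rule refl)
  have step: "norm (Y (Suc n) - Y n) \<le> r (Suc n) - r n" for n
  proof (induction n)
    case 0
    then show ?case using x by (simp add: YS rS Y0 r0)
  next
    case (Suc n)
    have "Y (Suc (Suc n)) - Y (Suc n) = (1/2) *\<^sub>R ((Y (Suc n) - Y n) * (Y (Suc n) + Y n))"
      unfolding YS[of "Suc n"] by (subst YS[of n]) (simp add: algebra_simps Ycomm[of n "Suc n"])
    moreover have "norm ((Y (Suc n) - Y n) * (Y (Suc n) + Y n))
        \<le> (r (Suc n) - r n) * (r (Suc n) + r n)"
      by (rule order_trans[OF norm_mult_ineq])
        (intro mult_mono Suc norm_ge_zero order_trans[OF norm_triangle_ineq] add_mono Yr
          order_trans[OF norm_ge_zero Suc])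
    moreover have "r (Suc (Suc n)) - r (Suc n) = (1/2) * ((r (Suc n) - r n) * (r (Suc n) + r n))"
      unfolding rS[of "Suc n"] by (subst rS[of n]) (simp add: algebra_simps)
    ultimately show ?case by simp
  qed
  have rmono: "r n \<le> r (Suc n)" for n
    using step[of n] norm_ge_zero order_trans by (metis diff_ge_0_iff_ge)
  have "convergent r"
    by (rule Bseq_mono_convergent[OF BseqI'[of r 1]]) (use rb rmono in \<open>auto intro: lift_Suc_mono_le simp: incseq_SucI\<close>)
  then obtain \<rho> where \<rho>: "r \<longlonglongrightarrow> \<rho>"
    by (auto simp: convergent_def)
  have "summable (\<lambda>n. r (Suc n) - r n)"
    using telescope_summable[OF \<rho>] .
  then have "summable (\<lambda>n. Y (Suc n) - Y n)"
    by (rule summable_comparison_test[rotated]) (use step in auto)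
  then have "convergent (\<lambda>n. \<Sum>i<n. Y (Suc i) - Y i)"
    by (simp add: summable_iff_convergent)
  then obtain y where y: "Y \<longlonglongrightarrow> y"
    by (auto simp: sum_lessThan_telescope Y0 convergent_def)
  show ?thesis
  proof
    show "norm y \<le> 1"
      by (rule LIMSEQ_le_const2[OF tendsto_norm[OF y]]) (use Yr rb order_trans in blast)
    have "star (Y n) = Y n" for n
      by (induction n) (auto simp: Y0 YS star_zero star_scaleR star_add star_mult x)
    then show "star y = y"
      using tendsto_star[OF y] y by (simp add: LIMSEQ_unique)
    have "(\<lambda>n. Y (Suc n)) \<longlonglongrightarrow> (1/2) *\<^sub>R (x + y * y)"
      unfolding YS by (intro tendsto_intros y)
    then have "y = (1/2) *\<^sub>R (x + y * y)"
      using LIMSEQ_Suc[OF y] LIMSEQ_unique by blast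
    then have "2 *\<^sub>R y = x + y * y" by (metis scaleR_half_double scaleR_2 scaleR_add_right)
    then show "(1 - y) * (1 - y) = 1 - x"
      by (simp add: algebra_simps scaleR_2)
    show "c * y = y * c" if "c * x = x * c" for c
      by (rule LIMSEQ_unique[OF tendsto_mult[OF tendsto_const y]])
        (simp add: comm[OF that], intro tendsto_intros y)
  qed
qed

text \<open>The bound \<open>norm (t - h) \<le> t\<close> is exactly what makes \<open>h / t = 1 - x\<close> with \<open>norm x \<le> 1\<close>.\<close>

lemma positive_sqrt:
  fixes h :: "'a::unital_cstar_algebra"
  assumes "cstar_positive h"
  obtains k
    where "cstar_positive k" "k * k = h" "\<And>c. c * h = h * c \<Longrightarrow> c * k = k * c"
proof -
  obtain t where t: "norm (of_real t - h) \<le> t" and h: "star h = h"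
    using assms by (auto simp: cstar_positive_def)
  have "0 \<le> t" using t norm_ge_zero order_trans by blast
  show ?thesis
  proof (cases "t = 0")
    case True
    then have "h = 0" using t by simp
    then show ?thesis using that[of 0] assms by simp
  next
    case False
    with \<open>0 \<le> t\<close> have tp: "0 < t" by simp
    define x where "x = 1 - (1/t) *\<^sub>R h"
    have "t *\<^sub>R x = of_real t - h"
      using tp by (simp add: x_def algebra_simps of_real_def)
    then have "t * norm x \<le> t"
      using t tp by (metis norm_scaleR abs_of_pos)
    then have nx: "norm x \<le> 1" using tp by simp
    have sx: "star x = x" by (simp add: x_def star_diff star_one star_scaleR h)
    obtain y where y: "norm y \<le> 1" "star y = y" "(1 - y) * (1 - y) = 1 - x"
      and yc: "\<And>c. c * x = x * c \<Longrightarrow> c * y = y * c"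
      using sqrt_one_minus[OF nx sx] by blast
    define k where "k = sqrt t *\<^sub>R (1 - y)"
    have "of_real (sqrt t) - k = sqrt t *\<^sub>R y"
      by (simp add: k_def of_real_def algebra_simps)
    then have "norm (of_real (sqrt t) - k) \<le> sqrt t"
      using y(1) tp by (simp add: mult_left_le)
    then have "cstar_positive k"
      by (intro positiveI) (auto simp: k_def star_scaleR star_diff star_one y)
    moreover have "k * k = h"
      using tp by (simp add: k_def y) (simp add: x_def)
    moreover have "c * k = k * c" if "c * h = h * c" for c
    proof -
      have "c * x = x * c" using that by (simp add: x_def algebra_simps)
      then show ?thesis using yc by (simp add: k_def algebra_simps)
    qed
    ultimately show ?thesis using that by blast
  qed
qed

text \<open>The element \<open>t - k\<^sup>2\<close> satisfies the norm criterion for free, hence is a square \<open>s\<^sup>2\<close>, and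
  \<open>s\<^sup>2 + k\<^sup>2 = t\<close> puts \<open>s\<close> on the circle of radius \<open>sqrt t\<close>. So squares of self-adjoint elements are
  positive, and the radius \<open>t\<close> in the criterion may be any number above the norm.\<close>

lemma norm_diff_square_le:
  fixes k :: "'a::unital_cstar_algebra"
  assumes k: "star k = k" and t: "norm (k * k) \<le> t"
  shows "norm (of_real t - k * k) \<le> t"
proof -
  have t0: "0 \<le> t" using t norm_ge_zero order_trans by blast
  have "cstar_positive (of_real t - k * k)"
    by (rule positiveI[of _ t]) (auto simp: star_diff star_of_real star_mult k t)
  then obtain s where s: "cstar_positive s" "s * s = of_real t - k * k"
      "\<And>c. c * (of_real t - k * k) = (of_real t - k * k) * c \<Longrightarrow> c * s = s * c"
    using positive_sqrt by blast
  have "k * s = s * k"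
    by (rule s(3)) (simp add: algebra_simps of_real_def)
  then have "norm s \<le> sqrt t"
    using t0 s(1,2) by (intro commuting_circle_bound[of s k]) (auto simp: positive_self k)
  then have "(norm s)\<^sup>2 \<le> t"
    using t0 by (metis norm_ge_zero power_mono real_sqrt_pow2)
  then show ?thesis
    using norm_self_square[of s] s(1,2) by (simp add: positive_self)
qed

lemma positive_square: "star k = k \<Longrightarrow> cstar_positive (k * k)"
  by (rule positiveI[OF _ norm_diff_square_le[OF _ order_refl]]) (auto simp: star_mult)

text \<open>That every \<open>t\<close> above the norm is admissible makes positivity stable under limits: one \<open>t\<close> serves a
  whole bounded sequence.\<close>

lemma positive_norm_diff:
  assumes "cstar_positive h" "norm h \<le> t"
  shows "norm (of_real t - h) \<le> t"
proof -
  obtain k where "cstar_positive k" "k * k = h" using positive_sqrt[OF assms(1)] by blast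
  then show ?thesis using norm_diff_square_le[of k t] assms(2) by (simp add: positive_self)
qed

lemma positive_zero: "cstar_positive 0"
  using positive_square[of 0] by (simp add: star_zero)

lemma positive_of_real: "0 \<le> r \<Longrightarrow> cstar_positive (of_real r)"
  by (rule positiveI[of _ r]) (auto simp: star_of_real)

lemma positive_add:
  assumes "cstar_positive a" "cstar_positive b"
  shows "cstar_positive (a + b)"
proof -
  obtain s t where "norm (of_real s - a) \<le> s" "norm (of_real t - b) \<le> t"
    using assms by (auto simp: cstar_positive_def)
  then have "norm ((of_real s - a) + (of_real t - b)) \<le> s + t"
    by (intro norm_triangle_le add_mono)
  then show ?thesis
    by (intro positiveI[of _ "s + t"]) (auto simp: star_add positive_self assms algebra_simps)
qed

lemma positive_sum: "(\<And>k. k \<in> I \<Longrightarrow> cstar_positive (f k)) \<Longrightarrow> cstar_positive (sum f I)"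
  by (induction I rule: infinite_finite_induct) (auto simp: positive_zero positive_add)

text \<open>The square roots commute as well, so the product is the square of their product.\<close>

lemma positive_mult_commuting:
  assumes "cstar_positive a" "cstar_positive b" "a * b = b * a"
  shows "cstar_positive (a * b)"
proof -
  obtain k
    where k: "cstar_positive k" "k * k = a" "\<And>c. c * a = a * c \<Longrightarrow> c * k = k * c"
    using positive_sqrt[OF assms(1)] by blast
  obtain l
    where l: "cstar_positive l" "l * l = b" "\<And>c. c * b = b * c \<Longrightarrow> c * l = l * c"
    using positive_sqrt[OF assms(2)] by blast
  have kl: "l * k = k * l" using k(3) l(3) assms(3) by metis
  then have "a * b = (k * l) * (k * l)"
    using k(2) l(2) by (metis mult.assoc)
  then show ?thesis
    using positive_square[of "k * l"] kl
      by (simp add: star_mult positive_self[OF k(1)] positive_self[OF l(1)])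
qed

lemma positive_scaleR: "cstar_positive a \<Longrightarrow> 0 \<le> r \<Longrightarrow> cstar_positive (r *\<^sub>R a)"
proof -
  assume "cstar_positive a" "0 \<le> r"
  then have "cstar_positive (of_real r * a)"
    by (intro positive_mult_commuting positive_of_real) (simp_all add: of_real_def)
  then show ?thesis by (simp add: of_real_def)
qed

lemma positive_norm_minus: "star b = b \<Longrightarrow> norm b \<le> t \<Longrightarrow> cstar_positive (of_real t - b)"
  by (rule positiveI[of _ t]) (auto simp: star_diff star_of_real)

text \<open>The product \<open>a (s - a)\<close> is a square \<open>p\<^sup>2\<close>, and completing the square turns this into
  \<open>(a - s/2)\<^sup>2 + p\<^sup>2 = (s/2)\<^sup>2\<close>.\<close>

lemma norm_le_of_positive:
  fixes a :: "'a::unital_cstar_algebra"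
  assumes a: "cstar_positive a" and sa: "cstar_positive (of_real s - a)"
  shows "norm a \<le> s"
proof -
  have "cstar_positive (of_real s :: 'a)" using positive_add[OF a sa] by simp
  then obtain t where "norm (of_real t - of_real s :: 'a) \<le> t"
    by (auto simp: cstar_positive_def)
  then have "\<bar>t - s\<bar> \<le> t" by (simp flip: of_real_diff)
  then have s0: "0 \<le> s" by linarith
  have "cstar_positive (a * (of_real s - a))"
    by (rule positive_mult_commuting[OF a sa]) (simp add: algebra_simps of_real_def)
  then obtain p where p: "cstar_positive p" "p * p = a * (of_real s - a)"
      "\<And>c. c * (a * (of_real s - a)) = a * (of_real s - a) * c \<Longrightarrow> c * p = p * c"
    using positive_sqrt by blast
  have "a * p = p * a" by (rule p(3)) (simp add: algebra_simps of_real_def)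
  define c where "c = (of_real (s/2) :: 'a)"
  have c: "of_real s = c + c" "c * c = of_real ((s/2)\<^sup>2)" "star c = c"
    by (simp_all add: c_def star_of_real power2_eq_square flip: of_real_add of_real_mult)
  have com: "c * z = z * c" for z by (simp add: c_def of_real_def)
  have "(a - c) * (a - c) + p * p = c * c"
    unfolding p(2) c(1) by (simp add: algebra_simps com[of a])
  also note c(2)
  finally have circ: "(a - c) * (a - c) + p * p = of_real ((s/2)\<^sup>2)" .
  have "star (a - c) = a - c" by (simp only: star_diff c(3) positive_self[OF a])
  moreover have "(a - c) * p = p * (a - c)"
    by (simp only: left_diff_distrib right_diff_distrib \<open>a * p = p * a\<close> com[of p])
  ultimately have "norm (a - c) \<le> s/2"
    using s0 by (intro commuting_circle_bound[OF _ positive_self[OF p(1)] _ circ]) auto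
  then show ?thesis
    using norm_triangle_sub[of a c] s0 by (simp add: c_def del: of_real_divide)
qed

text \<open>Insert the number \<open>norm b\<close>: it dominates \<open>b\<close> and therefore \<open>a\<close>.\<close>

lemma norm_mono:
  assumes "cstar_positive a" "cstar_positive (b - a)"
  shows "norm a \<le> norm b"
proof -
  have "cstar_positive b" using positive_add[OF assms] by simp
  then have "cstar_positive (of_real (norm b) - b)"
    by (intro positive_norm_minus) (auto simp: positive_self)
  from positive_add[OF this assms(2)] show ?thesis
    by (intro norm_le_of_positive[OF assms(1)]) simp
qed


lemma positive_limit:
  assumes pos: "\<And>n. cstar_positive (f n)"
    and lim: "f \<longlonglongrightarrow> (l::'a::unital_cstar_algebra)"
  shows "cstar_positive l"
proof -
  have "Bseq f" using lim convergent_def convergent_imp_Bseq by blast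
  then obtain t where t: "\<And>n. norm (f n) \<le> t" by (auto simp: Bseq_def)
  have "norm (of_real t - l) \<le> t"
    by (rule LIMSEQ_le_const2[where X = "\<lambda>n. norm (of_real t - f n)"])
      (auto intro!: tendsto_intros lim positive_norm_diff pos t)
  moreover have "star l = l"
    using tendsto_star[OF lim] lim by (simp add: positive_self[OF pos] LIMSEQ_unique)
  ultimately show ?thesis by (rule positiveI[rotated])
qed

section \<open>Positivity of \<open>star a * a\<close>\<close>

text \<open>Bernoulli's inequality multiplied by \<open>x\<close>. What matters is that \<open>x (1 + x)\<^sup>n\<close> grows at least
  linearly in \<open>n\<close>, unless \<open>x\<^sup>2 = 0\<close>.\<close>

lemma positive_Bernoulli:
  assumes x: "cstar_positive (x::'a::unital_cstar_algebra)"
  shows "cstar_positive (x * (1 + x) ^ n - (real n *\<^sub>R (x * x) + x))"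
proof (induction n)
  case (Suc n)
  define v where "v = (1 + x) ^ n"
  have vx: "v * x = x * v"
    unfolding v_def by (rule power_commuting_commutes) (simp add: algebra_simps)
  have sx: "star x = x" using x by (rule positive_self)
  have "cstar_positive ((1 + x) * (x * v - (real n *\<^sub>R (x * x) + x)))"
    using Suc positive_add[OF positive_of_real[of 1] x]
    by (intro positive_mult_commuting) (simp_all add: v_def[symmetric], simp add: algebra_simps vx)
  moreover have "cstar_positive (x * (x * x))"
    by (intro positive_mult_commuting x positive_square sx) (simp add: mult.assoc)
  then have "cstar_positive (real n *\<^sub>R (x * (x * x)))"
    by (rule positive_scaleR) simp
  ultimately have "cstar_positive ((1 + x) * (x * v - (real n *\<^sub>R (x * x) + x)) + real n *\<^sub>R (x * (x * x)))"
    by (rule positive_add)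
  also have "(1 + x) * (x * v - (real n *\<^sub>R (x * x) + x)) + real n *\<^sub>R (x * (x * x))
    = x * ((1 + x) * v) - (real (Suc n) *\<^sub>R (x * x) + x)"
    by (simp add: algebra_simps)
  finally show ?case by (simp add: v_def)
qed (simp add: positive_zero)

text \<open>Let \<open>w = b * star b\<close>. The sum \<open>star b * b + b * star b\<close> is always a sum of two self-adjoint squares,
  so \<open>w\<close> is positive here. Now \<open>w b = - b m\<close> gives \<open>(1 - w/t)\<^sup>n b = b (1 + m/t)\<^sup>n\<close>, whose left side
  stays bounded in \<open>n\<close> if \<open>t \<ge> norm w\<close>, while Bernoulli's inequality makes the right side grow unless
  \<open>m = 0\<close>.\<close>

lemma star_square_negative_zero:
  fixes b m :: "'a::unital_cstar_algebra"
  assumes m: "cstar_positive m" and b: "star b * b = - m"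
  shows "m = 0"
proof -
  define w where "w = b * star b"
  have neg1: "scaleC (- 1) z = - z" for z :: 'a
    using scaleR_scaleC[of "-1" z] by simp
  \<comment> \<open>twice the real and the imaginary part of \<open>b\<close>\<close>
  define p where "p = b + star b"
  define q where "q = scaleC \<i> (star b - b)"
  have "star p = p" by (simp add: p_def star_add star_star add.commute)
  moreover have "star q = q"
  proof -
    have "star q = scaleC (\<i> * (-1)) (b - star b)"
      by (simp add: q_def star_scaleC star_diff star_star)
    also have "\<dots> = q" unfolding q_def scaleC_scaleC[symmetric] neg1 by simp
    finally show ?thesis .
  qed
  ultimately have "cstar_positive (p * p + q * q)"
    by (intro positive_add positive_square)
  moreover have "q * q = - ((star b - b) * (star b - b))"
    by (simp add: q_def mult_scaleC_left mult_scaleC_right scaleC_scaleC neg1)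
  then have "p * p + q * q = 2 *\<^sub>R (w - m)"
    using b by (simp add: p_def w_def algebra_simps scaleR_2)
  ultimately have "cstar_positive ((1/2) *\<^sub>R (p * p + q * q) + m)"
    by (intro positive_add[OF _ m] positive_scaleR) simp_all
  with \<open>p * p + q * q = _\<close> have w: "cstar_positive w" by simp
  \<comment> \<open>adding 1 makes \<open>t\<close> invertible also when \<open>w = 0\<close>\<close>
  define t where "t = norm w + 1"
  have t: "t > 0" "norm (of_real t - w) \<le> t"
    using positive_norm_diff[OF w, of t] by (auto simp: t_def add_pos_nonneg intro: add_nonneg_pos)
  define x where "x = (1/t) *\<^sub>R m"
  define T where "T = 1 - (1/t) *\<^sub>R w"
  have x: "cstar_positive x" using m t by (simp add: x_def positive_scaleR)
  have "of_real t - w = t *\<^sub>R T" using t(1) by (simp add: T_def algebra_simps of_real_def)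
  then have T: "norm T \<le> 1" using t by (simp add: mult_le_cancel_left2)
  have "w * b = - (b * m)"
    unfolding w_def mult.assoc b by simp
  then have Tb: "T * b = b * (1 + x)"
    by (simp add: T_def x_def algebra_simps)
  have pow: "T ^ n * b = b * (1 + x) ^ n" for n
  proof (induction n)
    case (Suc n)
    have "T ^ Suc n * b = T * (T ^ n * b)" by (simp add: mult.assoc)
    also have "\<dots> = T * b * (1 + x) ^ n" unfolding Suc by (simp add: mult.assoc)
    also have "\<dots> = b * (1 + x) ^ Suc n" unfolding Tb by (simp add: mult.assoc)
    finally show ?case .
  qed simp
  have bound: "real n * norm (x * x) \<le> norm b * norm b / t" for n
  proof -
    have "cstar_positive (x * (1 + x) ^ n - real n *\<^sub>R (x * x))"
      using positive_add[OF positive_Bernoulli[OF x, of n] x] by (simp add: algebra_simps)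
    then have "norm (real n *\<^sub>R (x * x)) \<le> norm (x * (1 + x) ^ n)"
      by (intro norm_mono positive_scaleR positive_square positive_self x) simp_all
    also have "x * (1 + x) ^ n = - ((1/t) *\<^sub>R (star b * (T ^ n * b)))"
      unfolding pow mult.assoc[symmetric] b by (simp add: x_def)
    also have "norm \<dots> = norm (star b * (T ^ n * b)) / t" using t by simp
    also have "norm (star b * (T ^ n * b)) \<le> norm b * (1 * norm b)"
    proof -
      have "norm (T ^ n) \<le> 1"
        by (rule order_trans[OF norm_power_ineq]) (simp add: T power_le_one)
      then show ?thesis
        by (intro order_trans[OF norm_mult_ineq] mult_mono) (auto simp: norm_star)
    qed
    finally show ?thesis using t by (simp add: divide_right_mono)
  qed
  have "norm (x * x) = 0"
  proof (rule ccontr)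
    assume "norm (x * x) \<noteq> 0"
    then have "norm (x * x) > 0" by simp
    from reals_Archimedean3[OF this] obtain n where "norm b * norm b / t < real n * norm (x * x)"
      by blast
    with bound[of n] show False by simp
  qed
  then have "x = 0" using self_square_zero[OF positive_self[OF x]] by simp
  then show ?thesis using t by (simp add: x_def)
qed

text \<open>Let \<open>h = star a * a\<close> and \<open>k = sqrt (h\<^sup>2)\<close>, the absolute value of \<open>h\<close>; then \<open>n = k - h\<close> is twice the
  negative part of \<open>h\<close> and \<open>h n = - k n\<close>. Hence \<open>b = a n\<close> has \<open>star b * b = - k n\<^sup>2\<close> with \<open>k n\<^sup>2\<close> positive,
  which forces \<open>k n\<^sup>2 = 0\<close>, then \<open>n = 0\<close> and \<open>h = k\<close>.\<close>

theorem positive_star_mult_self: "cstar_positive (star a * (a::'a::unital_cstar_algebra))"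
proof -
  define h where "h = star a * a"
  have h: "star h = h" by (simp add: h_def star_mult star_star)
  obtain k where k: "cstar_positive k" "k * k = h * h"
      and comm: "\<And>c. c * (h * h) = h * h * c \<Longrightarrow> c * k = k * c"
    using positive_sqrt[OF positive_square[OF h]] by blast
  have hk: "h * k = k * h" by (rule comm) (simp add: mult.assoc)
  define n where "n = k - h"
  have n: "star n = n" by (simp add: n_def star_diff h positive_self[OF k(1)])
  have nn: "n * n = 2 *\<^sub>R (k * n)"
    by (simp add: n_def algebra_simps hk k(2) scaleR_2)
  have hn: "h * n = - (k * n)"
    by (simp add: n_def algebra_simps hk k(2))
  have kn: "k * n = n * k" by (simp add: n_def algebra_simps hk)
  have knn: "k * (n * n) = n * (n * k)" by (metis kn mult.assoc)
  have pos: "cstar_positive (n * (n * k))"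
    using positive_mult_commuting[OF positive_square[OF n] k(1)] knn by (simp add: mult.assoc)
  have "star (a * n) * (a * n) = n * (h * n)"
    by (simp add: star_mult n h_def mult.assoc)
  also have "\<dots> = - (n * (n * k))" unfolding hn by (simp add: kn)
  finally have "n * (n * k) = 0" by (rule star_square_negative_zero[OF pos])
  then have "n * (n * n) = 0" unfolding nn kn by simp
  then have "(n * n) * (n * n) = 0" by (simp add: mult.assoc)
  then have "n * n = 0" by (rule self_square_zero[rotated]) (simp add: star_mult n)
  then have "n = 0" by (rule self_square_zero[OF n])
  then show ?thesis using k(1) by (simp add: n_def h_def)
qed

lemma positive_star_sandwich:
  assumes "cstar_positive h"
  shows "cstar_positive (star c * h * c)"
proof -
  obtain k where k: "cstar_positive k" "k * k = h" using positive_sqrt[OF assms] by blast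
  have "star c * h * c = star (k * c) * (k * c)"
    by (simp add: star_mult positive_self[OF k(1)] k(2)[symmetric] mult.assoc)
  then show ?thesis by (simp add: positive_star_mult_self)
qed

section \<open>The standard Hilbert module as a Banach space\<close>

text \<open>For \<open>p = \<langle>x, x\<rangle>\<close>, \<open>q = \<langle>y, y\<rangle>\<close> and \<open>a = \<langle>x, y\<rangle>\<close> the assumption says that
  \<open>\<langle>x a - s y, x a - s y\<rangle>\<close> is positive. Since \<open>star a * p * a \<le> s (star a * a)\<close> as soon as \<open>norm p \<le> s\<close>, it
  yields \<open>star a * a \<le> s q\<close>.\<close>

lemma abstract_Cauchy_Schwarz:
  fixes a p q :: "'a::unital_cstar_algebra"
  assumes p: "cstar_positive p"
    and pos: "\<And>s. cstar_positive (star a * p * a - (2 * s) *\<^sub>R (star a * a) + s\<^sup>2 *\<^sub>R q)"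
  shows "(norm a)\<^sup>2 \<le> norm p * norm q"
proof -
  have *: "(norm a)\<^sup>2 \<le> s * norm q" if s: "s > 0" "norm p \<le> s" for s
  proof -
    have "cstar_positive (star a * (of_real s - p) * a)"
      by (intro positive_star_sandwich positive_norm_minus positive_self p s)
    then have "cstar_positive (s *\<^sub>R (star a * a) - star a * p * a)"
      by (simp add: algebra_simps of_real_def)
    from positive_add[OF this pos[of s]]
    have "cstar_positive (s *\<^sub>R (star a * a) + s\<^sup>2 *\<^sub>R q - (2 * s) *\<^sub>R (star a * a))"
      by (simp add: algebra_simps)
    also have "s *\<^sub>R (star a * a) + s\<^sup>2 *\<^sub>R q - (2 * s) *\<^sub>R (star a * a)
        = s\<^sup>2 *\<^sub>R q - s *\<^sub>R (star a * a)"
      by (simp only: scaleR_scaleR[symmetric] scaleR_2 scaleR_add_right) simp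
    finally have "cstar_positive ((1/s) *\<^sub>R (s\<^sup>2 *\<^sub>R q - s *\<^sub>R (star a * a)))"
      by (rule positive_scaleR) (use s in simp)
    also have "(1/s) *\<^sub>R (s\<^sup>2 *\<^sub>R q - s *\<^sub>R (star a * a)) = s *\<^sub>R q - star a * a"
      using s by (simp add: algebra_simps power2_eq_square)
    finally have "norm (star a * a) \<le> norm (s *\<^sub>R q)"
      by (rule norm_mono[OF positive_star_mult_self])
    then show ?thesis using s by (simp add: cstar_identity)
  qed
  show ?thesis
  proof (cases "norm p = 0")
    case True
    have "(norm a)\<^sup>2 \<le> 0 + e" if "e > 0" for e
    proof -
      \<comment> \<open>for \<open>norm p = 0\<close> every \<open>s > 0\<close> is admissible, and \<open>s\<close> tends to 0\<close>
      have "(norm a)\<^sup>2 \<le> (e / (norm q + 1)) * norm q"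
        using True that by (intro *) (auto intro!: divide_pos_pos add_nonneg_pos)
      also have "\<dots> \<le> e" using that
        by (simp add: pos_divide_le_eq add_nonneg_pos ring_distribs)
      finally show ?thesis by simp
    qed
    then have "(norm a)\<^sup>2 \<le> 0" by (rule field_le_epsilon)
    then show ?thesis using True by simp
  next
    case False
    then show ?thesis by (intro *) simp_all
  qed
qed


definition partial_inner :: "nat set \<Rightarrow> (nat \<Rightarrow> 'a::unital_cstar_algebra) \<Rightarrow> (nat \<Rightarrow> 'a) \<Rightarrow> 'a" where
  "partial_inner I x y = (\<Sum>k\<in>I. star (x k) * y k)"

definition partial_norm :: "nat set \<Rightarrow> (nat \<Rightarrow> 'a::unital_cstar_algebra) \<Rightarrow> real" where
  "partial_norm I x = sqrt (norm (partial_inner I x x))"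

lemma partial_norm_nonneg: "0 \<le> partial_norm I x"
  by (simp add: partial_norm_def)

lemma norm_partial_inner_self: "norm (partial_inner I x x) = (partial_norm I x)\<^sup>2"
  by (simp add: partial_norm_def)

lemma positive_partial_inner: "cstar_positive (partial_inner I x x)"
  unfolding partial_inner_def by (intro positive_sum positive_star_mult_self)

lemma partial_inner_add_left: "partial_inner I (x + y) z = partial_inner I x z + partial_inner I y z"
  by (simp add: partial_inner_def star_add distrib_right sum.distrib)

lemma partial_inner_add_right: "partial_inner I x (y + z) = partial_inner I x y + partial_inner I x z"
  by (simp add: partial_inner_def distrib_left sum.distrib)

lemma partial_inner_diff_left: "partial_inner I (x - y) z = partial_inner I x z - partial_inner I y z"
  by (simp add: partial_inner_def star_diff left_diff_distrib sum_subtractf)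

lemma partial_inner_diff_right: "partial_inner I x (y - z) = partial_inner I x y - partial_inner I x z"
  by (simp add: partial_inner_def right_diff_distrib sum_subtractf)

lemma partial_inner_ract_left: "partial_inner I (x \<odot> a) z = star a * partial_inner I x z"
  by (simp add: partial_inner_def ract_def star_mult sum_distrib_left mult.assoc)

lemma partial_inner_ract_right: "partial_inner I x (z \<odot> a) = partial_inner I x z * a"
  by (simp add: partial_inner_def ract_def sum_distrib_right mult.assoc)

lemma star_partial_inner: "star (partial_inner I x y) = partial_inner I y x"
  by (simp add: partial_inner_def star_sum star_mult star_star)

lemma partial_Cauchy_Schwarz:
  "norm (partial_inner I x y) \<le> partial_norm I x * partial_norm I y"
proof -
  define a where "a = partial_inner I x y"
  have yx: "partial_inner I y x = star a" by (simp add: a_def star_partial_inner)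
  have "(norm a)\<^sup>2 \<le> norm (partial_inner I x x) * norm (partial_inner I y y)"
  proof (rule abstract_Cauchy_Schwarz[OF positive_partial_inner])
    fix s :: real
    have "partial_inner I (x \<odot> a - y \<odot> of_real s) (x \<odot> a - y \<odot> of_real s) =
      star a * partial_inner I x x * a - (2 * s) *\<^sub>R (star a * a) + s\<^sup>2 *\<^sub>R partial_inner I y y"
      unfolding partial_inner_diff_left partial_inner_diff_right partial_inner_ract_left
        partial_inner_ract_right yx a_def[symmetric] star_of_real
        power2_eq_square
      by (simp add: algebra_simps of_real_def) (simp add: scaleR_2 mult.commute scaleR_add_right flip: scaleR_scaleR)
    then show "cstar_positive (star a * partial_inner I x x * a - (2 * s) *\<^sub>R (star a * a)
        + s\<^sup>2 *\<^sub>R partial_inner I y y)"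
      by (metis positive_partial_inner)
  qed
  then show ?thesis
    by (simp add: a_def norm_partial_inner_self power_mult_distrib[symmetric] partial_norm_nonneg)
qed

lemma partial_norm_triangle: "partial_norm I (x + y) \<le> partial_norm I x + partial_norm I y"
proof (rule power2_le_imp_le)
  have "(partial_norm I (x + y))\<^sup>2 = norm (partial_inner I x x + partial_inner I x y
      + (partial_inner I y x + partial_inner I y y))"
    by (simp only: norm_partial_inner_self[symmetric] partial_inner_add_left partial_inner_add_right) (simp add: algebra_simps)
  also have "\<dots> \<le> (partial_norm I x * partial_norm I x + partial_norm I x * partial_norm I y)
      + (partial_norm I y * partial_norm I x + partial_norm I y * partial_norm I y)"
    by (intro norm_triangle_le add_mono partial_Cauchy_Schwarz)
  also have "\<dots> = (partial_norm I x + partial_norm I y)\<^sup>2"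
    by (simp add: power2_eq_square algebra_simps)
  finally show "(partial_norm I (x + y))\<^sup>2 \<le> (partial_norm I x + partial_norm I y)\<^sup>2" .
qed (simp add: partial_norm_nonneg)

lemma partial_norm_ract: "partial_norm I (x \<odot> a) \<le> norm a * partial_norm I x"
proof (rule power2_le_imp_le)
  have "norm (star a * (partial_inner I x x * a)) \<le> norm a * (norm (partial_inner I x x) * norm a)"
    by (rule order_trans[OF norm_mult_ineq]) (simp add: norm_star mult_left_mono norm_mult_ineq)
  then show "(partial_norm I (x \<odot> a))\<^sup>2 \<le> (norm a * partial_norm I x)\<^sup>2"
    by (simp add: partial_inner_ract_left partial_inner_ract_right power_mult_distrib mult.assoc
      norm_partial_inner_self[symmetric] power2_eq_square[of "norm a"] mult.left_commute mult.commute)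
qed (simp add: partial_norm_nonneg)

text \<open>Enlarging the index set adds a positive element to the inner product.\<close>

lemma partial_norm_mono:
  assumes "finite J" "I \<subseteq> J"
  shows "partial_norm I x \<le> partial_norm J x"
proof -
  have "partial_inner J x x - partial_inner I x x = partial_inner (J - I) x x"
    using assms by (simp add: partial_inner_def sum_diff)
  then have "norm (partial_inner I x x) \<le> norm (partial_inner J x x)"
    by (intro norm_mono positive_partial_inner) (simp add: positive_partial_inner)
  then show ?thesis by (simp add: partial_norm_def)
qed

text \<open>In this form the membership condition is visibly stable under sums, by the triangle inequality for the
  seminorms \<open>partial_norm I\<close>.\<close>

lemma hmod_iff_small_tails:
  "x \<in> hmod \<longleftrightarrow> (\<forall>e>0. \<exists>N. \<forall>m\<ge>N. \<forall>n. partial_norm {m..<n} x < e)"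
proof
  assume L: "x \<in> hmod"
  show "\<forall>e>0. \<exists>N. \<forall>m\<ge>N. \<forall>n. partial_norm {m..<n} x < e"
  proof (intro allI impI)
    fix e :: real assume "e > 0"
    then have "e\<^sup>2 > 0" by simp
    with L obtain N
      where N: "\<forall>m\<ge>N. \<forall>n. norm (partial_inner {m..<n} x x) < e\<^sup>2"
      unfolding hmod_def summable_Cauchy partial_inner_def mem_Collect_eq by blast
    then show "\<exists>N. \<forall>m\<ge>N. \<forall>n. partial_norm {m..<n} x < e"
      using \<open>e > 0\<close> unfolding norm_partial_inner_self by (meson power2_less_imp_less less_imp_le)
  qed
next
  assume R: "\<forall>e>0. \<exists>N. \<forall>m\<ge>N. \<forall>n. partial_norm {m..<n} x < e"
  show "x \<in> hmod"
    unfolding hmod_def summable_Cauchy mem_Collect_eq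
  proof (intro allI impI)
    fix e :: real assume "e > 0"
    then obtain N where N: "\<forall>m\<ge>N. \<forall>n. partial_norm {m..<n} x < sqrt e"
      using R by (meson real_sqrt_gt_zero)
    show "\<exists>N. \<forall>m\<ge>N. \<forall>n. norm (\<Sum>k=m..<n. star (x k) * x k) < e"
      using N unfolding partial_norm_def partial_inner_def by auto
  qed
qed

lemma hmod_zero: "0 \<in> hmod"
  by (simp add: hmod_def)

lemma hmod_add:
  assumes "x \<in> hmod" "y \<in> hmod"
  shows "x + y \<in> hmod"
  unfolding hmod_iff_small_tails
proof (intro allI impI)
  fix e :: real assume "e > 0"
  then have e: "e/2 > 0" by simp
  obtain N where N: "\<forall>m\<ge>N. \<forall>n. partial_norm {m..<n} x < e/2"
    using assms(1) e unfolding hmod_iff_small_tails by blast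
  obtain N' where N': "\<forall>m\<ge>N'. \<forall>n. partial_norm {m..<n} y < e/2"
    using assms(2) e unfolding hmod_iff_small_tails by blast
  have "partial_norm {m..<n} (x + y) < e" if "m \<ge> max N N'" for m n
    using N N' that partial_norm_triangle[of "{m..<n}" x y]
    by (smt (verit) field_sum_of_halves max.boundedE)
  then show "\<exists>N. \<forall>m\<ge>N. \<forall>n. partial_norm {m..<n} (x + y) < e" by blast
qed

lemma hmod_ract:
  assumes "x \<in> hmod"
  shows "x \<odot> a \<in> hmod"
  unfolding hmod_iff_small_tails
proof (intro allI impI)
  fix e :: real assume "e > 0"
  then have e: "e / (norm a + 1) > 0" by (simp add: add_nonneg_pos)
  obtain N where N: "\<forall>m\<ge>N. \<forall>n. partial_norm {m..<n} x < e / (norm a + 1)"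
    using assms e unfolding hmod_iff_small_tails by blast
  have "partial_norm {m..<n} (x \<odot> a) < e" if "m \<ge> N" for m n
  proof -
    have "partial_norm {m..<n} (x \<odot> a) \<le> (norm a + 1) * partial_norm {m..<n} x"
      using partial_norm_ract[of "{m..<n}" x a] partial_norm_nonneg[of "{m..<n}" x]
      by (simp add: algebra_simps)
    also have "\<dots> < e" using N that
      by (simp add: pos_less_divide_eq add_nonneg_pos mult.commute)
    finally show ?thesis .
  qed
  then show "\<exists>N. \<forall>m\<ge>N. \<forall>n. partial_norm {m..<n} (x \<odot> a) < e"
    by blast
qed

lemma ract_minus_one: "x \<odot> (-1) = - x"
  by (auto simp: ract_def)

lemma ract_one: "x \<odot> 1 = x"
  by (auto simp: ract_def)

lemma ract_zero: "x \<odot> 0 = 0"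
  by (auto simp: ract_def)

lemma ract_ract: "(x \<odot> a) \<odot> b = x \<odot> (a * b)"
  by (auto simp: ract_def mult.assoc)

lemma ract_add_left: "(x + y) \<odot> a = x \<odot> a + y \<odot> a"
  by (auto simp: ract_def distrib_right)

lemma ract_diff_left: "(x - y) \<odot> a = x \<odot> a - y \<odot> a"
  by (auto simp: ract_def left_diff_distrib)

lemma hmod_uminus: "x \<in> hmod \<Longrightarrow> - x \<in> hmod"
  using hmod_ract[of x "-1"] by (simp add: ract_minus_one)

lemma hmod_diff: "x \<in> hmod \<Longrightarrow> y \<in> hmod \<Longrightarrow> x - y \<in> hmod"
  using hmod_add[OF _ hmod_uminus, of x y] by simp

lemma summable_hinner:
  assumes "x \<in> hmod" "y \<in> hmod"
  shows "summable (\<lambda>k. star (x k) * y k)"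
  unfolding summable_Cauchy
proof (intro allI impI)
  fix e :: real assume "e > 0"
  obtain N where N: "\<forall>m\<ge>N. \<forall>n. partial_norm {m..<n} x < 1"
    using assms(1) unfolding hmod_iff_small_tails by (meson zero_less_one)
  obtain N' where N': "\<forall>m\<ge>N'. \<forall>n. partial_norm {m..<n} y < e"
    using assms(2) \<open>e > 0\<close> unfolding hmod_iff_small_tails by blast
  have "norm (\<Sum>k=m..<n. star (x k) * y k) < e" if "m \<ge> max N N'" for m n
  proof -
    have "norm (partial_inner {m..<n} x y) \<le> partial_norm {m..<n} x * partial_norm {m..<n} y"
      by (rule partial_Cauchy_Schwarz)
    also have "\<dots> \<le> 1 * partial_norm {m..<n} y"
      using N that by (intro mult_right_mono partial_norm_nonneg) (simp add: less_imp_le)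
    also have "\<dots> < e" using N' that by simp
    finally show ?thesis by (simp add: partial_inner_def)
  qed
  then show "\<exists>N. \<forall>m\<ge>N. \<forall>n. norm (\<Sum>k=m..<n. star (x k) * y k) < e"
    by blast
qed

lemma partial_inner_tendsto:
  "x \<in> hmod \<Longrightarrow> y \<in> hmod \<Longrightarrow> (\<lambda>n. partial_inner {..<n} x y) \<longlonglongrightarrow> hinner x y"
  unfolding partial_inner_def hinner_def by (intro summable_LIMSEQ summable_hinner)

lemma hinner_add_left:
  "x \<in> hmod \<Longrightarrow> y \<in> hmod \<Longrightarrow> z \<in> hmod \<Longrightarrow> hinner (x + y) z = hinner x z + hinner y z"
  by (simp add: hinner_def star_add distrib_right suminf_add summable_hinner)

lemma hinner_add_right:
  "x \<in> hmod \<Longrightarrow> y \<in> hmod \<Longrightarrow> z \<in> hmod \<Longrightarrow> hinner x (y + z) = hinner x y + hinner x z"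
  by (simp add: hinner_def distrib_left suminf_add summable_hinner)

lemma hinner_diff_left:
  "x \<in> hmod \<Longrightarrow> y \<in> hmod \<Longrightarrow> z \<in> hmod \<Longrightarrow> hinner (x - y) z = hinner x z - hinner y z"
  by (simp add: hinner_def star_diff left_diff_distrib suminf_diff summable_hinner)

lemma hinner_diff_right:
  "x \<in> hmod \<Longrightarrow> y \<in> hmod \<Longrightarrow> z \<in> hmod \<Longrightarrow> hinner x (y - z) = hinner x y - hinner x z"
  by (simp add: hinner_def right_diff_distrib suminf_diff summable_hinner)

lemma hinner_ract_left:
  "x \<in> hmod \<Longrightarrow> y \<in> hmod \<Longrightarrow> hinner (x \<odot> a) y = star a * hinner x y"
  by (simp add: hinner_def ract_def star_mult mult.assoc suminf_mult summable_hinner)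

lemma hinner_ract_right:
  "x \<in> hmod \<Longrightarrow> y \<in> hmod \<Longrightarrow> hinner x (y \<odot> a) = hinner x y * a"
  by (simp add: hinner_def ract_def suminf_mult2 summable_hinner flip: mult.assoc)

lemma star_hinner:
  assumes "x \<in> hmod" "y \<in> hmod"
  shows "star (hinner x y) = hinner y x"
  using LIMSEQ_unique[OF tendsto_star[OF partial_inner_tendsto[OF assms]]]
    partial_inner_tendsto[OF assms(2,1)] by (simp add: star_partial_inner)

lemma positive_hinner: "x \<in> hmod \<Longrightarrow> cstar_positive (hinner x x)"
  by (rule positive_limit[OF positive_partial_inner partial_inner_tendsto])

lemma hnorm_nonneg: "0 \<le> hnorm x"
  by (simp add: hnorm_def)

lemma norm_hinner_self: "norm (hinner x x) = (hnorm x)\<^sup>2"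
  by (simp add: hnorm_def)

lemma partial_norm_tendsto: "x \<in> hmod \<Longrightarrow> (\<lambda>n. partial_norm {..<n} x) \<longlonglongrightarrow> hnorm x"
  unfolding partial_norm_def hnorm_def by (intro tendsto_intros partial_inner_tendsto)

lemma partial_norm_le_hnorm:
  assumes "x \<in> hmod" "finite I"
  shows "partial_norm I x \<le> hnorm x"
proof -
  obtain N where N: "I \<subseteq> {..<N}" using assms(2) finite_nat_bounded by blast
  have "partial_norm I x \<le> partial_norm {..<n} x" if "n \<ge> N" for n
    using N that by (intro partial_norm_mono) auto
  then show ?thesis
    by (intro LIMSEQ_le_const[OF partial_norm_tendsto[OF assms(1)]]) blast
qed

lemma norm_component_le_hnorm: "x \<in> hmod \<Longrightarrow> norm (x k) \<le> hnorm x"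
  using partial_norm_le_hnorm[of x "{k}"]
    by (simp add: partial_norm_def partial_inner_def cstar_identity)

lemma hinner_Cauchy_Schwarz:
  assumes "x \<in> hmod" "y \<in> hmod"
  shows "norm (hinner x y) \<le> hnorm x * hnorm y"
  by (rule LIMSEQ_le[OF tendsto_norm[OF partial_inner_tendsto[OF assms]]
      tendsto_mult[OF partial_norm_tendsto[OF assms(1)] partial_norm_tendsto[OF assms(2)]]])
    (simp add: partial_Cauchy_Schwarz)

lemma hnorm_triangle:
  assumes "x \<in> hmod" "y \<in> hmod"
  shows "hnorm (x + y) \<le> hnorm x + hnorm y"
  by (rule LIMSEQ_le[OF partial_norm_tendsto[OF hmod_add[OF assms]]
      tendsto_add[OF partial_norm_tendsto[OF assms(1)] partial_norm_tendsto[OF assms(2)]]])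
    (simp add: partial_norm_triangle)

lemma hnorm_ract:
  assumes "x \<in> hmod"
  shows "hnorm (x \<odot> a) \<le> norm a * hnorm x"
  by (rule LIMSEQ_le[OF partial_norm_tendsto[OF hmod_ract[OF assms]]
      tendsto_mult[OF tendsto_const partial_norm_tendsto[OF assms]]])
    (simp add: partial_norm_ract)

lemma hnorm_zero: "hnorm 0 = 0"
  by (simp add: hnorm_def hinner_def)

lemma hnorm_eq_zero: "x \<in> hmod \<Longrightarrow> hnorm x = 0 \<longleftrightarrow> x = 0"
  using norm_component_le_hnorm[of x] by (fastforce simp: hnorm_zero)

lemma hnorm_minus_commute: "hnorm (x - y) = hnorm (y - x)"
proof -
  have "star ((x - y) k) * (x - y) k = star ((y - x) k) * (y - x) k" for k
    by (simp add: star_diff algebra_simps)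
  then show ?thesis by (simp add: hnorm_def hinner_def)
qed

lemma hnorm_ract_of_real: "x \<in> hmod \<Longrightarrow> hnorm (x \<odot> of_real r) = \<bar>r\<bar> * hnorm x"
proof -
  assume x: "x \<in> hmod"
  have "hinner (x \<odot> of_real r) (x \<odot> of_real r) = r\<^sup>2 *\<^sub>R hinner x x"
    using x by (simp add: hinner_ract_left hinner_ract_right hmod_ract star_of_real power2_eq_square
      flip: scaleR_conv_of_real) (simp add: of_real_def)
  then show ?thesis by (simp add: hnorm_def real_sqrt_mult)
qed

lemma hmod_metric: "Metric_space hmod (\<lambda>x y. hnorm (x - y))"
proof
  show "hnorm (x - z) \<le> hnorm (x - y) + hnorm (y - z)"
    if "x \<in> hmod" "y \<in> hmod" "z \<in> hmod" for x y z :: "nat \<Rightarrow> 'a"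
    using hnorm_triangle[OF hmod_diff hmod_diff, of x y y z] that by simp
qed (auto simp: hnorm_nonneg hnorm_minus_commute hnorm_eq_zero hmod_diff)

interpretation hm: Metric_space hmod "\<lambda>x y. hnorm (x - y)"
  by (rule hmod_metric)

text \<open>Componentwise limits exist because each component is dominated by the norm. The finite
  seminorms pass to the limit uniformly in the index set, which shows both that the limit has small tails
  and that the convergence is in norm.\<close>

lemma hmod_complete:
  "Metric_space.mcomplete hmod (\<lambda>x y :: nat \<Rightarrow> 'a::unital_cstar_algebra. hnorm (x - y))"
  unfolding hm.mcomplete_def
proof (intro allI impI)
  fix \<sigma> :: "nat \<Rightarrow> nat \<Rightarrow> 'a"
  assume "hm.MCauchy \<sigma>"
  then have \<sigma>: "\<And>n. \<sigma> n \<in> hmod"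
    and cau: "\<And>e. e > 0 \<Longrightarrow> \<exists>N. \<forall>n n'. N \<le> n \<longrightarrow> N \<le> n' \<longrightarrow> hnorm (\<sigma> n - \<sigma> n') < e"
    unfolding hm.MCauchy_def by auto
  have "Cauchy (\<lambda>n. \<sigma> n k)" for k
    unfolding Cauchy_iff
  proof (intro allI impI)
    fix e :: real assume "e > 0"
    from cau[OF this] obtain N
      where N: "\<forall>n n'. N \<le> n \<longrightarrow> N \<le> n' \<longrightarrow> hnorm (\<sigma> n - \<sigma> n') < e" by blast
    have "norm (\<sigma> m k - \<sigma> n k) < e" if "m \<ge> N" "n \<ge> N" for m n
      using norm_component_le_hnorm[OF hmod_diff[OF \<sigma>[of m] \<sigma>[of n]], of k] N that
      by (auto intro: order_le_less_trans)
    then show "\<exists>M. \<forall>m\<ge>M. \<forall>n\<ge>M. norm (\<sigma> m k - \<sigma> n k) < e"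
      by blast
  qed
  then obtain l where l: "\<And>k. (\<lambda>n. \<sigma> n k) \<longlonglongrightarrow> l k"
    unfolding Cauchy_convergent_iff convergent_def by metis
  have lim: "(\<lambda>m. partial_norm I (\<sigma> n - \<sigma> m)) \<longlonglongrightarrow> partial_norm I (\<sigma> n - l)"
    for I n
    unfolding partial_norm_def partial_inner_def minus_apply
    by (intro tendsto_intros tendsto_star l)
  have close: "\<exists>N. \<forall>n\<ge>N. \<forall>I. finite I \<longrightarrow> partial_norm I (\<sigma> n - l) \<le> e"
    if e: "e > 0" for e
  proof -
    obtain N
      where N: "\<forall>n n'. N \<le> n \<longrightarrow> N \<le> n' \<longrightarrow> hnorm (\<sigma> n - \<sigma> n') < e" using cau[OF e] by blast
    have "partial_norm I (\<sigma> n - l) \<le> e" if "n \<ge> N" "finite I" for n I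
    proof (rule LIMSEQ_le_const2[OF lim])
      show "\<exists>N. \<forall>m\<ge>N. partial_norm I (\<sigma> n - \<sigma> m) \<le> e"
        using N that partial_norm_le_hnorm[OF hmod_diff[OF \<sigma> \<sigma>] \<open>finite I\<close>]
        by (meson less_imp_le order_trans)
    qed
    then show ?thesis by blast
  qed
  have "l \<in> hmod"
    unfolding hmod_iff_small_tails
  proof (intro allI impI)
    fix e :: real assume "e > 0"
    then have e: "e/2 > 0" by simp
    obtain K
      where K: "\<And>I. finite I \<Longrightarrow> partial_norm I (\<sigma> K - l) \<le> e/2"
      using close[OF e] by blast
    obtain N where N: "\<forall>m\<ge>N. \<forall>n. partial_norm {m..<n} (\<sigma> K) < e/2"
      using \<sigma>[of K] e unfolding hmod_iff_small_tails by blast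
    have "partial_norm {m..<n} l < e" if "m \<ge> N" for m n
    proof -
      have "partial_norm {m..<n} (l - \<sigma> K) = partial_norm {m..<n} (\<sigma> K - l)"
        by (simp add: partial_norm_def partial_inner_def star_diff algebra_simps)
      then show ?thesis
        using partial_norm_triangle[of "{m..<n}" "\<sigma> K" "l - \<sigma> K"] K[of "{m..<n}"] N that
        by (auto simp: algebra_simps) (smt (verit) field_sum_of_halves)
    qed
    then show "\<exists>N. \<forall>m\<ge>N. \<forall>n. partial_norm {m..<n} l < e" by blast
  qed
  moreover have "\<exists>N. \<forall>n\<ge>N. \<sigma> n \<in> hmod \<and> hnorm (\<sigma> n - l) < e"
    if e: "e > 0" for e
  proof -
    obtain N
      where N: "\<And>n I. n \<ge> N \<Longrightarrow> finite I \<Longrightarrow> partial_norm I (\<sigma> n - l) \<le> e/2"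
      using close[OF half_gt_zero[OF e]] by blast
    have "hnorm (\<sigma> n - l) \<le> e/2" if "n \<ge> N" for n
      by (rule LIMSEQ_le_const2[OF partial_norm_tendsto[OF hmod_diff[OF \<sigma> \<open>l \<in> hmod\<close>]]])
        (use N that in auto)
    moreover have "e/2 < e" using e by simp
    ultimately show ?thesis using \<sigma> by (meson order_le_less_trans)
  qed
  ultimately have "limitin hm.mtopology \<sigma> l sequentially"
    unfolding hm.limit_metric_sequentially by blast
  then show "\<exists>x. limitin hm.mtopology \<sigma> x sequentially" by (rule exI[of _ l])
qed


section \<open>Bounded module maps and adjointable operators\<close>

definition bounded_module_map :: "((nat \<Rightarrow> 'a::unital_cstar_algebra) \<Rightarrow> nat \<Rightarrow> 'a) \<Rightarrow> bool" where
  "bounded_module_map T \<longleftrightarrow> T ` hmod \<subseteq> hmod \<and> module_linear_on hmod T \<and> bounded_on hmod T"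

lemma bounded_module_mapI:
  assumes "\<And>x. x \<in> hmod \<Longrightarrow> T x \<in> hmod"
    and "\<And>x y. x \<in> hmod \<Longrightarrow> y \<in> hmod \<Longrightarrow> T (x + y) = T x + T y"
    and "\<And>x a. x \<in> hmod \<Longrightarrow> T (x \<odot> a) = T x \<odot> a"
    and "\<And>x. x \<in> hmod \<Longrightarrow> hnorm (T x) \<le> C * hnorm x"
  shows "bounded_module_map T"
  using assms unfolding bounded_module_map_def module_linear_on_def bounded_on_def by blast

context
  fixes T :: "(nat \<Rightarrow> 'a::unital_cstar_algebra) \<Rightarrow> nat \<Rightarrow> 'a"
  assumes T: "bounded_module_map T"
begin

lemma module_map_in_hmod: "x \<in> hmod \<Longrightarrow> T x \<in> hmod"
  using T by (auto simp: bounded_module_map_def)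

lemma module_map_add: "x \<in> hmod \<Longrightarrow> y \<in> hmod \<Longrightarrow> T (x + y) = T x + T y"
  using T by (auto simp: bounded_module_map_def module_linear_on_def)

lemma module_map_ract: "x \<in> hmod \<Longrightarrow> T (x \<odot> a) = T x \<odot> a"
  using T by (auto simp: bounded_module_map_def module_linear_on_def)

lemma module_map_zero: "T 0 = 0"
  using module_map_ract[OF hmod_zero, of 0] by (simp add: ract_zero)

lemma module_map_diff:
  assumes "x \<in> hmod" "y \<in> hmod"
  shows "T (x - y) = T x - T y"
  using module_map_add[OF hmod_diff[OF assms] assms(2)] by (simp add: eq_diff_eq)

lemma module_map_bound:
  obtains C where "C > 0" "\<And>x. x \<in> hmod \<Longrightarrow> hnorm (T x) \<le> C * hnorm x"
proof -
  obtain C where C: "\<And>x. x \<in> hmod \<Longrightarrow> hnorm (T x) \<le> C * hnorm x"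
    using T by (auto simp: bounded_module_map_def bounded_on_def)
  have "hnorm (T x) \<le> max C 1 * hnorm x" if "x \<in> hmod" for x
    using C[OF that] mult_right_mono[of C "max C 1" "hnorm x"] hnorm_nonneg[of x] by simp
  then show ?thesis using that[of "max C 1"] by simp
qed

end

lemma bounded_module_map_compose:
  assumes T: "bounded_module_map T" and U: "bounded_module_map U"
  shows "bounded_module_map (\<lambda>x. T (U x))"
proof -
  obtain C where C: "C > 0" "\<And>x. x \<in> hmod \<Longrightarrow> hnorm (T x) \<le> C * hnorm x"
    using module_map_bound[OF T] by blast
  obtain C'
    where C': "C' > 0" "\<And>x. x \<in> hmod \<Longrightarrow> hnorm (U x) \<le> C' * hnorm x" using module_map_bound[OF U] by blast
  have "hnorm (T (U x)) \<le> (C * C') * hnorm x" if "x \<in> hmod" for x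
    using order_trans[OF C(2)[OF module_map_in_hmod[OF U that]] mult_left_mono[OF C'(2)[OF that]]] C(1)
    by (simp add: mult.assoc)
  then show ?thesis
    by (intro bounded_module_mapI)
      (auto simp: module_map_in_hmod[OF T] module_map_in_hmod[OF U] module_map_add[OF T] module_map_add[OF U] module_map_ract[OF T] module_map_ract[OF U])
qed

lemma bounded_module_map_add:
  assumes T: "bounded_module_map T" and U: "bounded_module_map U"
  shows "bounded_module_map (\<lambda>x. T x + U x)"
proof -
  obtain C where C: "C > 0" "\<And>x. x \<in> hmod \<Longrightarrow> hnorm (T x) \<le> C * hnorm x"
    using module_map_bound[OF T] by blast
  obtain C'
    where C': "C' > 0" "\<And>x. x \<in> hmod \<Longrightarrow> hnorm (U x) \<le> C' * hnorm x" using module_map_bound[OF U] by blast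
  have "hnorm (T x + U x) \<le> (C + C') * hnorm x" if "x \<in> hmod" for x
    using hnorm_triangle[OF module_map_in_hmod[OF T that] module_map_in_hmod[OF U that]] C(2)[OF that] C'(2)[OF that]
    by (simp add: distrib_right)
  then show ?thesis
    by (intro bounded_module_mapI)
      (auto simp: module_map_in_hmod[OF T] module_map_in_hmod[OF U] module_map_add[OF T] module_map_add[OF U] module_map_ract[OF T] module_map_ract[OF U]
        ract_add_left hmod_add)
qed

lemma bounded_module_map_zero: "bounded_module_map (\<lambda>x. 0)"
  by (rule bounded_module_mapI[where C = 0]) (auto simp: hmod_zero hnorm_zero ract_def)

lemma bounded_module_map_id: "bounded_module_map (\<lambda>x. x)"
  by (rule bounded_module_mapI[where C = 1]) auto

lemma bounded_module_map_ract_central: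
  assumes "\<alpha> \<in> center"
  shows "bounded_module_map (\<lambda>x. x \<odot> \<alpha>)"
proof (rule bounded_module_mapI[where C = "norm \<alpha>"])
  show "x \<odot> a \<odot> \<alpha> = x \<odot> \<alpha> \<odot> a" for x :: "nat \<Rightarrow> 'a"
    and a
    using assms unfolding ract_ract center_def by auto
qed (simp_all add: hmod_ract hnorm_ract ract_add_left)

lemma Ba_bounded_module_map: "T \<in> Ba \<Longrightarrow> bounded_module_map T"
  by (simp add: Ba_def bounded_module_map_def)

lemma BaI:
  assumes "bounded_module_map T"
    and "\<And>y. y \<in> hmod \<Longrightarrow> S y \<in> hmod"
    and "\<And>x y. x \<in> hmod \<Longrightarrow> y \<in> hmod \<Longrightarrow> hinner (T x) y = hinner x (S y)"
  shows "T \<in> Ba"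
  using assms unfolding Ba_def bounded_module_map_def by blast

definition adjoint_pair ::
  "((nat \<Rightarrow> 'a::unital_cstar_algebra) \<Rightarrow> nat \<Rightarrow> 'a) \<Rightarrow> ((nat \<Rightarrow> 'a) \<Rightarrow> nat \<Rightarrow> 'a) \<Rightarrow> bool" where
  "adjoint_pair T S \<longleftrightarrow> (\<forall>x\<in>hmod. \<forall>y\<in>hmod. hinner (T x) y = hinner x (S y))"

lemma adjoint_pairD:
  "adjoint_pair T S \<Longrightarrow> x \<in> hmod \<Longrightarrow> y \<in> hmod \<Longrightarrow> hinner (T x) y = hinner x (S y)"
  by (simp add: adjoint_pair_def)

lemma hinner_left_nondegenerate:
  assumes "y \<in> hmod" "z \<in> hmod" "\<And>x. x \<in> hmod \<Longrightarrow> hinner x y = hinner x z"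
  shows "y = z"
proof -
  have "hinner (y - z) (y - z) = 0"
    using assms by (simp add: hinner_diff_right hmod_diff)
  then have "hnorm (y - z) = 0" by (simp add: hnorm_def)
  then show ?thesis using assms by (simp add: hnorm_eq_zero hmod_diff)
qed

text \<open>The definition of \<open>Ba\<close> asks only for a function \<open>S\<close> with the adjoint identity; linearity and
  boundedness of \<open>S\<close> follow from nondegeneracy of the inner product and from
  \<open>\<langle>S y, S y\<rangle> = \<langle>T (S y), y\<rangle>\<close>.\<close>

lemma Ba_adjoint:
  assumes "T \<in> Ba"
  obtains S where "S \<in> Ba" "adjoint_pair T S" "adjoint_pair S T"
proof -
  have T: "bounded_module_map T" using assms by (rule Ba_bounded_module_map)
  have "\<exists>S. S ` hmod \<subseteq> hmod \<and> (\<forall>x\<in>hmod. \<forall>y\<in>hmod. hinner (T x) y = hinner x (S y))"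
    using assms by (simp add: Ba_def)
  then obtain S
    where "S ` hmod \<subseteq> hmod" "\<forall>x\<in>hmod. \<forall>y\<in>hmod. hinner (T x) y = hinner x (S y)"
    by (elim exE conjE)
  then have S: "\<And>y. y \<in> hmod \<Longrightarrow> S y \<in> hmod"
    and adj: "\<And>x y. x \<in> hmod \<Longrightarrow> y \<in> hmod \<Longrightarrow> hinner (T x) y = hinner x (S y)"
    by auto
  obtain C where C: "C > 0" "\<And>x. x \<in> hmod \<Longrightarrow> hnorm (T x) \<le> C * hnorm x"
    using module_map_bound[OF T] by blast
  have "bounded_module_map S"
  proof (rule bounded_module_mapI[where C = C])
    show "S (x + y) = S x + S y" if "x \<in> hmod" "y \<in> hmod" for x y
      using that by (intro hinner_left_nondegenerate)
        (simp_all add: S hmod_add hinner_add_right module_map_in_hmod[OF T] flip: adj)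
    show "S (x \<odot> a) = S x \<odot> a" if "x \<in> hmod" for x a
      using that by (intro hinner_left_nondegenerate)
        (simp_all add: S hmod_ract hinner_ract_right module_map_in_hmod[OF T] flip: adj)
    show "hnorm (S y) \<le> C * hnorm y" if y: "y \<in> hmod" for y
    proof (cases "hnorm (S y) = 0")
      case True
      then show ?thesis using C(1) hnorm_nonneg[of y] by simp
    next
      case False
      have "hnorm (S y) * hnorm (S y) = norm (hinner (T (S y)) y)"
        using y by (simp add: adj S norm_hinner_self power2_eq_square)
      also have "\<dots> \<le> hnorm (T (S y)) * hnorm y"
        using y by (intro hinner_Cauchy_Schwarz) (simp_all add: S module_map_in_hmod[OF T])
      also have "\<dots> \<le> (C * hnorm (S y)) * hnorm y"
        using y by (intro mult_right_mono C(2) S hnorm_nonneg)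
      also have "\<dots> = hnorm (S y) * (C * hnorm y)" by simp
      finally show ?thesis using False hnorm_nonneg[of "S y"]
        by (simp add: mult_le_cancel_left)
    qed
  qed (rule S)
  moreover have adj': "hinner (S x) y = hinner x (T y)" if "x \<in> hmod" "y \<in> hmod" for x y
    using adj[OF that(2,1)] star_hinner[of "S x" y] star_hinner[of x "T y"] that S module_map_in_hmod[OF T]
    by (metis star_hinner)
  ultimately have "S \<in> Ba" using module_map_in_hmod[OF T] by (intro BaI[of S T])
  moreover have "adjoint_pair T S" "adjoint_pair S T"
    unfolding adjoint_pair_def using adj adj' by blast+
  ultimately show ?thesis by (rule that)
qed

lemma Ba_compose:
  assumes "T \<in> Ba" "U \<in> Ba"
  shows "(\<lambda>x. T (U x)) \<in> Ba"
proof -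
  obtain T' where T': "T' \<in> Ba" "adjoint_pair T T'"
    using Ba_adjoint[OF assms(1)] by blast
  obtain U' where U': "U' \<in> Ba" "adjoint_pair U U'"
    using Ba_adjoint[OF assms(2)] by blast
  note [simp] = assms[THEN Ba_bounded_module_map, THEN module_map_in_hmod]
    T'(1)[THEN Ba_bounded_module_map, THEN module_map_in_hmod] U'(1)[THEN Ba_bounded_module_map, THEN module_map_in_hmod]
  show ?thesis
    by (rule BaI[where S = "\<lambda>x. U' (T' x)"])
      (simp_all add: bounded_module_map_compose Ba_bounded_module_map assms adjoint_pairD[OF T'(2)] adjoint_pairD[OF U'(2)])
qed

lemma Ba_add:
  assumes "T \<in> Ba" "U \<in> Ba"
  shows "(\<lambda>x. T x + U x) \<in> Ba"
proof -
  obtain T' where T': "T' \<in> Ba" "adjoint_pair T T'"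
    using Ba_adjoint[OF assms(1)] by blast
  obtain U' where U': "U' \<in> Ba" "adjoint_pair U U'"
    using Ba_adjoint[OF assms(2)] by blast
  note [simp] = assms[THEN Ba_bounded_module_map, THEN module_map_in_hmod]
    T'(1)[THEN Ba_bounded_module_map, THEN module_map_in_hmod] U'(1)[THEN Ba_bounded_module_map, THEN module_map_in_hmod]
  show ?thesis
    by (rule BaI[where S = "\<lambda>x. T' x + U' x"])
      (simp_all add: bounded_module_map_add Ba_bounded_module_map assms hinner_add_left hinner_add_right
        hmod_add adjoint_pairD[OF T'(2)] adjoint_pairD[OF U'(2)])
qed

lemma center_star: "\<alpha> \<in> center \<Longrightarrow> star \<alpha> \<in> center"
  unfolding center_def by (auto, metis star_mult star_star)

lemma Ba_ract_central:
  assumes "\<alpha> \<in> center"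
  shows "(\<lambda>x. x \<odot> \<alpha>) \<in> Ba"
proof (rule BaI[OF bounded_module_map_ract_central[OF assms], where S = "\<lambda>x. x \<odot> star \<alpha>"])
  show "hinner (x \<odot> \<alpha>) y = hinner x (y \<odot> star \<alpha>)"
    if "x \<in> hmod" "y \<in> hmod" for x y
    using that center_star[OF assms] by (simp add: hinner_ract_left hinner_ract_right center_def)
qed (rule hmod_ract)

lemma Ba_id: "(\<lambda>x. x) \<in> Ba"
  by (rule BaI[where S = "\<lambda>x. x"]) (simp_all add: bounded_module_map_id)

lemma center_one: "1 \<in> center"
  and center_uminus: "\<alpha> \<in> center \<Longrightarrow> - \<alpha> \<in> center"
  by (auto simp: center_def)

lemma ract_uminus: "x \<odot> (- a) = - (x \<odot> a)"
  by (auto simp: ract_def)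

lemma Ba_diff_ract_central: "T \<in> Ba \<Longrightarrow> \<alpha> \<in> center \<Longrightarrow> (\<lambda>x. T x - x \<odot> \<alpha>) \<in> Ba"
  using Ba_add[OF _ Ba_ract_central[OF center_uminus], of T \<alpha>] by (simp add: ract_uminus)

lemma Ba_diff:
  assumes "T \<in> Ba" "U \<in> Ba"
  shows "(\<lambda>x. T x - U x) \<in> Ba"
  using Ba_add[OF assms(1) Ba_compose[OF Ba_ract_central[OF center_uminus[OF center_one]] assms(2)]]
  by (simp add: ract_uminus ract_one)

text \<open>Membership in \<open>Ba\<close> is insensitive to the values outside \<open>hmod\<close>, which are arbitrary for
  projections given by a definite description.\<close>

lemma Ba_cong:
  assumes "T \<in> Ba" "\<And>x. x \<in> hmod \<Longrightarrow> U x = T x"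
  shows "U \<in> Ba"
proof -
  obtain S where S: "S \<in> Ba" "adjoint_pair T S"
    using Ba_adjoint[OF assms(1)] by blast
  have "bounded_module_map U"
    using Ba_bounded_module_map[OF assms(1)] assms(2)
    by (simp add: bounded_module_map_def module_linear_on_def bounded_on_def hmod_add hmod_ract)
  then show ?thesis
    by (rule BaI[where S = S])
      (simp_all add: assms(2) module_map_in_hmod Ba_bounded_module_map S(1) adjoint_pairD[OF S(2)])
qed

section \<open>Right inverses of surjective adjointable operators\<close>

text \<open>Uniform boundedness. For \<open>y\<close> with \<open>hnorm (S y) \<le> 1\<close> the functionals \<open>\<langle>\<cdot>, y\<rangle>\<close> are bounded at every point
  \<open>z = T x\<close>, by \<open>hnorm x\<close>. By Baire's theorem they are uniformly bounded on a ball, and testing with a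
  multiple of \<open>y\<close> itself bounds \<open>hnorm y\<close>.\<close>

lemma adjoint_of_surjective_bounded_below:
  fixes T :: "(nat \<Rightarrow> 'a::unital_cstar_algebra) \<Rightarrow> nat \<Rightarrow> 'a"
  assumes T: "T ` hmod = hmod" and S: "bounded_module_map S"
    and pair: "adjoint_pair T S"
  obtains c where "c > 0" "\<And>y. y \<in> hmod \<Longrightarrow> c * hnorm y \<le> hnorm (S y)"
proof -
  define B where "B = {y \<in> hmod. hnorm (S y) \<le> 1}"
  define F where "F n = {z \<in> hmod. \<forall>y\<in>B. norm (hinner z y) \<le> real n}"
    for n :: nat
  have Bh: "y \<in> hmod" if "y \<in> B" for y using that by (simp add: B_def)
  have closed: "closedin hm.mtopology (F n)" for n
    unfolding hm.metric_closedin_iff_sequentially_closed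
  proof (intro conjI allI impI)
    show "F n \<subseteq> hmod" by (auto simp: F_def)
    fix \<sigma> and l :: "nat \<Rightarrow> 'a"
    assume *: "range \<sigma> \<subseteq> F n \<and> limitin hm.mtopology \<sigma> l sequentially"
    then have l: "l \<in> hmod" and \<sigma>: "\<And>k. \<sigma> k \<in> F n"
      and lim: "\<And>e. e > 0 \<Longrightarrow> \<exists>N. \<forall>k\<ge>N. hnorm (\<sigma> k - l) < e"
      unfolding hm.limit_metric_sequentially by (blast, blast, meson)
    have \<sigma>h: "\<sigma> k \<in> hmod" for k using \<sigma>[of k] by (simp add: F_def)
    have "norm (hinner l y) \<le> real n" if y: "y \<in> B" for y
    proof (rule field_le_epsilon)
      fix e :: real assume "e > 0"
      define \<delta> where "\<delta> = e / (hnorm y + 1)"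
      have y1: "hnorm y + 1 > 0" by (simp add: add_nonneg_pos hnorm_nonneg)
      then have "\<delta> > 0" using \<open>e > 0\<close> by (simp add: \<delta>_def)
      then obtain k where k: "hnorm (\<sigma> k - l) < \<delta>" using lim by blast
      have "hinner l y = hinner (\<sigma> k) y - hinner (\<sigma> k - l) y"
        using l \<sigma>h y Bh by (simp add: hinner_diff_left)
      then have "norm (hinner l y) \<le> norm (hinner (\<sigma> k) y) + norm (hinner (\<sigma> k - l) y)"
        by (simp add: norm_triangle_ineq4)
      also have "\<dots> \<le> real n + hnorm (\<sigma> k - l) * hnorm y"
        using \<sigma>[of k] y
          by (intro add_mono hinner_Cauchy_Schwarz hmod_diff \<sigma>h l Bh) (auto simp: F_def)
      also have "hnorm (\<sigma> k - l) * hnorm y \<le> \<delta> * (hnorm y + 1)"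
        using k \<open>\<delta> > 0\<close> by (intro mult_mono) (auto simp: hnorm_nonneg)
      also have "\<dots> = e" using y1 by (simp add: \<delta>_def)
      finally show "norm (hinner l y) \<le> real n + e" by simp
    qed
    then show "l \<in> F n" using l by (simp add: F_def)
  qed
  have cover: "\<Union>(range F) = hmod"
  proof
    show "hmod \<subseteq> \<Union>(range F)"
    proof
      fix z :: "nat \<Rightarrow> 'a" assume z: "z \<in> hmod"
      then obtain x where x: "x \<in> hmod" "z = T x" using T by blast
      obtain n where n: "hnorm x \<le> real n" using real_arch_simple by blast
      have "norm (hinner z y) \<le> real n" if y: "y \<in> B" for y
      proof -
        have "norm (hinner z y) \<le> hnorm x * hnorm (S y)"
          unfolding x(2) adjoint_pairD[OF pair x(1) Bh[OF y]]
          by (intro hinner_Cauchy_Schwarz x module_map_in_hmod[OF S] Bh y)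
        also have "\<dots> \<le> hnorm x * 1" using y
          by (intro mult_left_mono) (auto simp: B_def hnorm_nonneg)
        finally show ?thesis using n by simp
      qed
      then show "z \<in> \<Union>(range F)" using z by (auto simp: F_def)
    qed
  qed (auto simp: F_def)
  have "\<exists>n. hm.mtopology interior_of (F n) \<noteq> {}"
  proof (rule ccontr)
    assume "\<not> ?thesis"
    then have "hm.mtopology interior_of \<Union>(range F) = {}"
      using closed by (intro hm.metric_Baire_category_alt[OF hmod_complete]) auto
    moreover have "hm.mtopology interior_of (hmod :: (nat \<Rightarrow> 'a) set) = hmod"
      using interior_of_topspace[of "hm.mtopology"] by simp
    ultimately show False using hmod_zero cover by auto
  qed
  then obtain n z0 where z0i: "z0 \<in> hm.mtopology interior_of (F n)" by blast
  have sub: "hm.mtopology interior_of (F n) \<subseteq> F n" by (rule interior_of_subset)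
  have "openin hm.mtopology (hm.mtopology interior_of (F n))" by simp
  then have "\<exists>r>0. hm.mball z0 r \<subseteq> hm.mtopology interior_of (F n)"
    using z0i unfolding hm.openin_mtopology by blast
  then obtain r where r: "r > 0" "hm.mball z0 r \<subseteq> F n"
    using sub by (elim exE conjE) (rule that, assumption, rule order_trans)
  have z0: "z0 \<in> F n" using z0i sub by (rule subsetD[rotated])
  then have z0h: "z0 \<in> hmod" by (simp add: F_def)
  \<comment> \<open>differences of two points of the ball in \<open>F n\<close> cover a ball about 0\<close>
  have small: "norm (hinner u y) \<le> 2 * real n" if "u \<in> hmod" "hnorm u < r" "y \<in> B"
    for u y
  proof -
    have "z0 + u \<in> hm.mball z0 r"
      using that hnorm_minus_commute[of z0 "z0 + u"] by (simp add: hm.in_mball z0h hmod_add)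
    then have "z0 + u \<in> F n" using r(2) by blast
    then have zu: "norm (hinner (z0 + u) y) \<le> real n" using that(3) by (simp add: F_def)
    have "hinner u y = hinner (z0 + u) y - hinner z0 y"
      using that z0h Bh by (simp add: hinner_add_left)
    then have "norm (hinner u y) \<le> norm (hinner (z0 + u) y) + norm (hinner z0 y)"
      by (simp add: norm_triangle_ineq4)
    then show ?thesis using zu z0 that(3) by (auto simp: F_def)
  qed
  \<comment> \<open>the summand 1 makes \<open>K\<close> positive and the bound strict\<close>
  define K where "K = 4 * real n / r + 1"
  have K: "K > 0" using r(1) by (simp add: K_def add_nonneg_pos)
  have bound: "hnorm y < K" if y: "y \<in> B" for y
  proof (cases "hnorm y = 0")
    case True
    then show ?thesis using K by simp
  next
    case False
    then have y0: "hnorm y > 0" using hnorm_nonneg[of y] by simp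
    define s where "s = r / (2 * hnorm y)"
    have s: "s > 0" using r(1) y0 by (simp add: s_def)
    have "hnorm (y \<odot> of_real s) = r/2"
      using s y0 Bh[OF y] by (simp add: hnorm_ract_of_real) (simp add: s_def)
    then have "norm (hinner (y \<odot> of_real s) y) \<le> 2 * real n"
      using r(1) y Bh by (intro small hmod_ract) auto
    also have "hinner (y \<odot> of_real s) y = s *\<^sub>R hinner y y"
      using Bh[OF y] by (simp add: hinner_ract_left star_of_real scaleR_conv_of_real)
    also have "norm \<dots> = r * hnorm y / 2"
      using s y0 by (simp add: norm_hinner_self) (simp add: s_def power2_eq_square)
    finally have "hnorm y \<le> 4 * real n / r" using r(1) by (simp add: field_simps)
    then show ?thesis by (simp add: K_def)
  qed
  have "(1/K) * hnorm y \<le> hnorm (S y)" if y: "y \<in> hmod" for y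
  proof (cases "hnorm (S y) = 0")
    case True
    have "hnorm y = 0"
    proof (rule ccontr)
      assume y0: "hnorm y \<noteq> 0"
      \<comment> \<open>if \<open>S y = 0\<close>, all multiples of \<open>y\<close> lie in \<open>B\<close>, also one of norm \<open>K\<close>\<close>
      define s where "s = K / hnorm y"
      have "hnorm (S (y \<odot> of_real s)) = 0"
        using True y
          by (simp add: module_map_ract[OF S] hnorm_ract_of_real module_map_in_hmod[OF S])
      then have "hnorm (y \<odot> of_real s) < K"
        using y by (intro bound) (simp add: B_def hmod_ract)
      moreover have "hnorm (y \<odot> of_real s) = K"
        using y y0 K hnorm_nonneg[of y] by (simp add: hnorm_ract_of_real s_def)
      ultimately show False by simp
    qed
    then show ?thesis by (simp add: hnorm_nonneg)
  next
    case False
    then have Sy: "hnorm (S y) > 0" using hnorm_nonneg[of "S y"] by simp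
    have "hnorm (S (y \<odot> of_real (1 / hnorm (S y)))) = 1"
      using y Sy
        by (simp add: module_map_ract[OF S] hnorm_ract_of_real module_map_in_hmod[OF S] del: of_real_divide)
    then have "hnorm (y \<odot> of_real (1 / hnorm (S y))) < K"
      using y by (intro bound) (simp add: B_def hmod_ract)
    then have "hnorm y / hnorm (S y) < K"
      using y Sy by (simp add: hnorm_ract_of_real del: of_real_divide)
    then show ?thesis using Sy K by (simp add: field_simps)
  qed
  then show ?thesis using that[of "1/K"] K by simp
qed

text \<open>A continuity method. For large \<open>s\<close> the equation \<open>Q x + s x = y\<close> is a contraction problem. The
  lower bound, uniform in \<open>s\<close>, controls the inverse of \<open>Q + s\<close>, so that solvability at \<open>s + c/2\<close> gives
  solvability at \<open>s\<close>, again by contraction; finitely many such steps reach 0.\<close>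

lemma coercive_surjective:
  fixes Q :: "(nat \<Rightarrow> 'a::unital_cstar_algebra) \<Rightarrow> nat \<Rightarrow> 'a"
  assumes Q: "bounded_module_map Q" and c: "c > 0"
    and coer: "\<And>s y. s \<ge> 0 \<Longrightarrow> y \<in> hmod \<Longrightarrow> c * hnorm y \<le> hnorm (Q y + y \<odot> of_real s)"
  shows "Q ` hmod = hmod"
proof -
  define solvable where
    "solvable s \<longleftrightarrow> (\<forall>y\<in>hmod. \<exists>x\<in>hmod. Q x + x \<odot> of_real s = y)"
      for s :: real
  have fixpoint: "\<exists>x\<in>hmod. f x = x"
    if "\<And>x. x \<in> hmod \<Longrightarrow> f x \<in> hmod"
      "\<And>x y. x \<in> hmod \<Longrightarrow> y \<in> hmod \<Longrightarrow> hnorm (f x - f y) \<le> (1/2) * hnorm (x - y)"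
    for f :: "(nat \<Rightarrow> 'a) \<Rightarrow> nat \<Rightarrow> 'a"
    by (rule hm.Banach_fixedpoint_thm[OF hmod_complete, of f "1/2"]) (use that hmod_zero in auto)
  obtain C where C: "C > 0" "\<And>x. x \<in> hmod \<Longrightarrow> hnorm (Q x) \<le> C * hnorm x"
    using module_map_bound[OF Q] by blast
  have large: "solvable s" if s: "s \<ge> 2 * C" for s
    unfolding solvable_def
  proof
    fix y :: "nat \<Rightarrow> 'a" assume y: "y \<in> hmod"
    have s0: "s > 0" using s C(1) by linarith
    have "\<exists>x\<in>hmod. (y - Q x) \<odot> of_real (1/s) = x"
    proof (rule fixpoint)
      fix x x' :: "nat \<Rightarrow> 'a" assume x: "x \<in> hmod" "x' \<in> hmod"
      have "(y - Q x) \<odot> of_real (1/s) - (y - Q x') \<odot> of_real (1/s) = Q (x' - x) \<odot> of_real (1/s)"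
        by (simp only: ract_diff_left[symmetric] module_map_diff[OF Q x(2,1)]) simp
      then have "hnorm ((y - Q x) \<odot> of_real (1/s) - (y - Q x') \<odot> of_real (1/s)) = hnorm (Q (x' - x)) / s"
        using s0 x
          by (simp add: hnorm_ract_of_real module_map_in_hmod[OF Q] hmod_diff del: of_real_divide)
      also have "\<dots> \<le> C * hnorm (x' - x) / s"
        using s0 x by (intro divide_right_mono C hmod_diff) auto
      also have "\<dots> = (C / s) * hnorm (x - x')" by (simp add: hnorm_minus_commute)
      also have "\<dots> \<le> (1/2) * hnorm (x - x')"
        using s s0 by (intro mult_right_mono hnorm_nonneg) (simp add: field_simps)
      finally show "hnorm ((y - Q x) \<odot> of_real (1/s) - (y - Q x') \<odot> of_real (1/s)) \<le> (1/2) * hnorm (x - x')" .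
    qed (intro hmod_ract hmod_diff y module_map_in_hmod[OF Q])
    then obtain x where x: "x \<in> hmod" "(y - Q x) \<odot> of_real (1/s) = x" by blast
    have "x \<odot> of_real s = ((y - Q x) \<odot> of_real (1/s)) \<odot> of_real s" using x(2)
      by simp
    also have "\<dots> = y - Q x"
      using s0 by (simp only: ract_ract of_real_mult[symmetric]) (simp add: ract_one)
    finally have "Q x + x \<odot> of_real s = y" by simp
    then show "\<exists>x\<in>hmod. Q x + x \<odot> of_real s = y" using x(1) by blast
  qed
  \<comment> \<open>half of the lower bound, so that the inverse of \<open>Q + s + \<eta>\<close> times \<open>\<eta>\<close> has norm at most 1/2\<close>
  define \<eta> where "\<eta> = c / 2"
  have \<eta>: "\<eta> > 0" using c by (simp add: \<eta>_def)
  have ract_of_real_add: "x \<odot> of_real (s + t) = x \<odot> of_real s + x \<odot> of_real t"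
    for x :: "nat \<Rightarrow> 'a" and s t
    by (auto simp: ract_def distrib_left)
  have down: "solvable s" if s: "s \<ge> 0" "solvable (s + \<eta>)" for s
    unfolding solvable_def
  proof
    fix y :: "nat \<Rightarrow> 'a" assume y: "y \<in> hmod"
    obtain V where V: "\<And>u. u \<in> hmod \<Longrightarrow> V u \<in> hmod"
      "\<And>u. u \<in> hmod \<Longrightarrow> Q (V u) + V u \<odot> of_real (s + \<eta>) = u"
      using s(2) unfolding solvable_def by metis
    have "\<exists>x\<in>hmod. V (y + x \<odot> of_real \<eta>) = x"
    proof (rule fixpoint)
      fix x x' :: "nat \<Rightarrow> 'a" assume x: "x \<in> hmod" "x' \<in> hmod"
      define u where "u = y + x \<odot> of_real \<eta>"
      define u' where "u' = y + x' \<odot> of_real \<eta>"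
      have u: "u \<in> hmod" "u' \<in> hmod" using x y
        by (auto simp: u_def u'_def hmod_add hmod_ract)
      have "c * hnorm (V u - V u') \<le> hnorm (Q (V u - V u') + (V u - V u') \<odot> of_real (s + \<eta>))"
        using s(1) \<eta> u V(1) by (intro coer hmod_diff) auto
      also have "Q (V u - V u') + (V u - V u') \<odot> of_real (s + \<eta>)
          = (Q (V u) + V u \<odot> of_real (s + \<eta>)) - (Q (V u') + V u' \<odot> of_real (s + \<eta>))"
        by (simp only: module_map_diff[OF Q V(1)[OF u(1)] V(1)[OF u(2)]] ract_diff_left) (simp add: algebra_simps)
      also have "\<dots> = (x - x') \<odot> of_real \<eta>"
        unfolding V(2)[OF u(1)] V(2)[OF u(2)] by (simp add: u_def u'_def ract_diff_left)
      also have "hnorm \<dots> = c * ((1/2) * hnorm (x - x'))"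
        using x \<eta> by (simp add: hnorm_ract_of_real hmod_diff) (simp add: \<eta>_def)
      finally show "hnorm (V (y + x \<odot> of_real \<eta>) - V (y + x' \<odot> of_real \<eta>)) \<le> (1/2) * hnorm (x - x')"
        using c by (simp only: u_def[symmetric] u'_def[symmetric] mult_le_cancel_left_pos)
    qed (intro V hmod_add hmod_ract y)
    then obtain x where x: "x \<in> hmod" "V (y + x \<odot> of_real \<eta>) = x" by blast
    have "Q x + x \<odot> of_real (s + \<eta>) = y + x \<odot> of_real \<eta>"
      using V(2)[of "y + x \<odot> of_real \<eta>"] x y by (simp add: hmod_add hmod_ract)
    then have "Q x + x \<odot> of_real s = y" unfolding ract_of_real_add
      by (simp add: algebra_simps)
    then show "\<exists>x\<in>hmod. Q x + x \<odot> of_real s = y" using x(1) by blast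
  qed
  have reach: "solvable (real n * \<eta>) \<Longrightarrow> solvable 0" for n
  proof (induction n)
    case (Suc n)
    then show ?case using down[of "real n * \<eta>"] \<eta> by (simp add: algebra_simps)
  qed simp
  obtain n where "2 * C \<le> real n * \<eta>"
    using reals_Archimedean3[OF \<eta>] less_imp_le by blast
  then have "solvable 0" by (rule reach[OF large])
  then have "\<forall>y\<in>hmod. \<exists>x\<in>hmod. Q x = y"
    by (simp add: solvable_def ract_zero)
  then show ?thesis using module_map_in_hmod[OF Q] by (auto simp: image_iff)
qed

text \<open>With the adjoint \<open>S\<close> of \<open>T\<close>, the right inverse is \<open>S\<close> composed with the inverse of \<open>Q = T S\<close>. The coercivity
  estimate for \<open>Q + s\<close> comes from \<open>\<langle>y, (Q + s) y\<rangle> = \<langle>S y, S y\<rangle> + s \<langle>y, y\<rangle>\<close>: the second term is positive, so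
  that dropping it can only decrease the norm.\<close>

theorem surjective_right_inverse:
  fixes T :: "(nat \<Rightarrow> 'a::unital_cstar_algebra) \<Rightarrow> nat \<Rightarrow> 'a"
  assumes T: "T \<in> Ba" and surj: "T ` hmod = hmod"
  obtains R where "bounded_module_map R" "\<And>y. y \<in> hmod \<Longrightarrow> T (R y) = y"
proof -
  have TM: "bounded_module_map T" using T by (rule Ba_bounded_module_map)
  obtain S where S: "S \<in> Ba" and pair: "adjoint_pair T S" and "adjoint_pair S T"
    using Ba_adjoint[OF T] by blast
  then have adj': "\<And>x y. x \<in> hmod \<Longrightarrow> y \<in> hmod \<Longrightarrow> hinner (S x) y = hinner x (T y)"
    by (simp add: adjoint_pairD)
  have SM: "bounded_module_map S" using S by (rule Ba_bounded_module_map)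
  obtain c where c: "c > 0" "\<And>y. y \<in> hmod \<Longrightarrow> c * hnorm y \<le> hnorm (S y)"
    using adjoint_of_surjective_bounded_below[OF surj SM pair] by blast
  define Q where "Q = (\<lambda>y. T (S y))"
  have Q: "bounded_module_map Q"
    unfolding Q_def by (rule bounded_module_map_compose[OF TM SM])
  have coer: "c\<^sup>2 * hnorm y \<le> hnorm (Q y + y \<odot> of_real s)" if s: "s \<ge> 0"
    and y: "y \<in> hmod" for s y
  proof (cases "hnorm y = 0")
    case True
    then show ?thesis by (simp add: hnorm_nonneg)
  next
    case False
    have "(c * hnorm y)\<^sup>2 \<le> (hnorm (S y))\<^sup>2"
      using c y by (intro power_mono) (auto simp: hnorm_nonneg)
    also have "\<dots> = norm (hinner (S y) (S y))" by (simp add: norm_hinner_self)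
    also have "\<dots> \<le> norm (hinner y (Q y + y \<odot> of_real s))"
    proof (rule norm_mono)
      show "cstar_positive (hinner (S y) (S y))"
        by (rule positive_hinner[OF module_map_in_hmod[OF SM y]])
      have "hinner y (Q y + y \<odot> of_real s) - hinner (S y) (S y) = s *\<^sub>R hinner y y"
        using y
          by (simp add: hinner_add_right hinner_ract_right hmod_ract module_map_in_hmod[OF Q] adj'
            module_map_in_hmod[OF SM]) (simp add: Q_def of_real_def)
      then show "cstar_positive (hinner y (Q y + y \<odot> of_real s) - hinner (S y) (S y))"
        using positive_scaleR[OF positive_hinner[OF y] s] by simp
    qed
    also have "\<dots> \<le> hnorm y * hnorm (Q y + y \<odot> of_real s)"
      using y by (intro hinner_Cauchy_Schwarz hmod_add hmod_ract module_map_in_hmod[OF Q])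
    finally have "hnorm y * (c\<^sup>2 * hnorm y) \<le> hnorm y * hnorm (Q y + y \<odot> of_real s)"
      by (simp add: power2_eq_square algebra_simps)
    then show ?thesis using False hnorm_nonneg[of y] by (simp add: mult_le_cancel_left)
  qed
  have "Q ` hmod = hmod"
    by (rule coercive_surjective[OF Q _ coer]) (use c(1) in simp_all)
  then have "\<forall>y\<in>hmod. \<exists>x. x \<in> hmod \<and> Q x = y" by (metis imageE)
  from bchoice[OF this] obtain V where "\<forall>y\<in>hmod. V y \<in> hmod \<and> Q (V y) = y"
    by (elim exE)
  then have V: "\<And>y. y \<in> hmod \<Longrightarrow> V y \<in> hmod" "\<And>y. y \<in> hmod \<Longrightarrow> Q (V y) = y"
    by auto
  \<comment> \<open>the case \<open>s = 0\<close> also makes the inverse of \<open>Q\<close> well defined and bounded\<close>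
  have below: "c\<^sup>2 * hnorm y \<le> hnorm (Q y)" if "y \<in> hmod" for y
    using coer[OF order_refl that] by (simp add: ract_zero)
  have inj: "y = z" if "y \<in> hmod" "z \<in> hmod" "Q y = Q z" for y z
  proof -
    have "c\<^sup>2 * hnorm (y - z) \<le> 0"
      using below[OF hmod_diff[OF that(1,2)]] that by (simp add: module_map_diff[OF Q] hnorm_zero)
    then have "hnorm (y - z) = 0" using c hnorm_nonneg[of "y - z"] by (simp add: mult_le_0_iff)
    then show ?thesis using that by (simp add: hnorm_eq_zero hmod_diff)
  qed
  have "bounded_module_map V"
  proof (rule bounded_module_mapI[where C = "1 / c\<^sup>2"])
    show "V (x + y) = V x + V y" if "x \<in> hmod" "y \<in> hmod" for x y
      by (rule inj) (use that in \<open>simp_all add: V hmod_add module_map_add[OF Q]\<close>)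
    show "V (x \<odot> a) = V x \<odot> a" if "x \<in> hmod" for x a
      by (rule inj) (use that in \<open>simp_all add: V hmod_ract module_map_ract[OF Q]\<close>)
    show "hnorm (V x) \<le> (1 / c\<^sup>2) * hnorm x" if "x \<in> hmod" for x
      using below[OF V(1)[OF that]] that c by (simp add: V field_simps)
  qed (rule V(1))
  then show ?thesis
    using that[of "\<lambda>y. S (V y)"] V(2) bounded_module_map_compose[OF SM] by (simp add: Q_def)
qed


section \<open>Closed submodules and projections\<close>

text \<open>Ranges and kernels of bounded idempotents have this form; this is how every submodule of the
  decomposition constructed below is seen to be closed.\<close>

lemma closed_submodule_equalizer:
  fixes A B :: "(nat \<Rightarrow> 'a::unital_cstar_algebra) \<Rightarrow> nat \<Rightarrow> 'a"
  assumes A: "bounded_module_map A" and B: "bounded_module_map B"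
  shows "closed_submodule {x \<in> hmod. A x = B x}"
proof -
  have cont: "limitin hm.mtopology (\<lambda>n. T (\<sigma> n)) (T l) sequentially"
    if T: "bounded_module_map T" and lim: "limitin hm.mtopology \<sigma> l sequentially"
    for T and \<sigma> :: "nat \<Rightarrow> nat \<Rightarrow> 'a" and l
    unfolding hm.limit_metric_sequentially
  proof (intro conjI allI impI)
    have l: "l \<in> hmod" using lim hm.limit_metric_sequentially by blast
    then show "T l \<in> hmod" by (rule module_map_in_hmod[OF T])
    fix e :: real assume "e > 0"
    obtain C
      where C: "C > 0" "\<And>x. x \<in> hmod \<Longrightarrow> hnorm (T x) \<le> C * hnorm x" using module_map_bound[OF T] by blast
    have "e / C > 0" using C(1) \<open>e > 0\<close> by simp
    then obtain N
      where N: "\<forall>n\<ge>N. \<sigma> n \<in> hmod \<and> hnorm (\<sigma> n - l) < e / C"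
      using lim unfolding hm.limit_metric_sequentially by blast
    have "T (\<sigma> n) \<in> hmod \<and> hnorm (T (\<sigma> n) - T l) < e" if n: "n \<ge> N" for n
    proof
      have \<sigma>: "\<sigma> n \<in> hmod" "hnorm (\<sigma> n - l) < e / C" using N n by auto
      show "T (\<sigma> n) \<in> hmod" by (rule module_map_in_hmod[OF T \<sigma>(1)])
      have "hnorm (T (\<sigma> n) - T l) \<le> C * hnorm (\<sigma> n - l)"
        using C(2)[OF hmod_diff[OF \<sigma>(1) l]]
          by (simp add: module_map_diff[OF T \<sigma>(1) l])
      also have "\<dots> < e" using \<sigma>(2) C(1) by (simp add: field_simps)
      finally show "hnorm (T (\<sigma> n) - T l) < e" .
    qed
    then show "\<exists>N. \<forall>n\<ge>N. T (\<sigma> n) \<in> hmod \<and> hnorm (T (\<sigma> n) - T l) < e"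
      by blast
  qed
  have "closedin hm.mtopology {x \<in> hmod. A x = B x}"
    unfolding hm.metric_closedin_iff_sequentially_closed
  proof (intro conjI allI impI)
    fix \<sigma> and l :: "nat \<Rightarrow> 'a"
    assume *: "range \<sigma> \<subseteq> {x \<in> hmod. A x = B x} \<and> limitin hm.mtopology \<sigma> l sequentially"
    then have lim: "limitin hm.mtopology \<sigma> l sequentially" ..
    have "A (\<sigma> n) = B (\<sigma> n)" for n using * by (auto simp: image_subset_iff)
    then have "limitin hm.mtopology (\<lambda>n. A (\<sigma> n)) (B l) sequentially"
      using cont[OF B lim] by simp
    with cont[OF A lim] have "A l = B l" by (rule hm.limitin_metric_unique) simp
    moreover have "l \<in> hmod" using lim hm.limit_metric_sequentially by blast
    ultimately show "l \<in> {x \<in> hmod. A x = B x}" by simp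
  qed auto
  then show ?thesis
    unfolding closed_submodule_def hmod_topology_def
    by (auto simp: hmod_zero hmod_add hmod_ract module_map_zero[OF A] module_map_zero[OF B] module_map_add[OF A] module_map_add[OF B]
        module_map_ract[OF A] module_map_ract[OF B])
qed

lemma closed_submodule_Int:
  "closed_submodule M \<Longrightarrow> closed_submodule N \<Longrightarrow> closed_submodule (M \<inter> N)"
  unfolding closed_submodule_def by auto

lemma closed_submodule_hmod: "closed_submodule M \<Longrightarrow> x \<in> M \<Longrightarrow> x \<in> hmod"
  unfolding closed_submodule_def by blast

lemma closed_submodule_diff:
  assumes "closed_submodule M" "x \<in> M" "y \<in> M"
  shows "x - y \<in> M"
proof -
  have "x + y \<odot> (-1) \<in> M" using assms unfolding closed_submodule_def by blast
  then show ?thesis by (simp add: ract_minus_one)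
qed

lemma proj_along_eq:
  assumes d: "dsum hmod M N" and "m \<in> M" "n \<in> N"
  shows "proj_along M N (m + n) = m"
  unfolding proj_along_def
proof (rule the_equality)
  show "m \<in> M \<and> (\<exists>n'\<in>N. m + n = m + n')" using assms by blast
  fix m' assume m': "m' \<in> M \<and> (\<exists>n'\<in>N. m + n = m' + n')"
  then obtain n' where n': "n' \<in> N" "m + n = m' + n'" by blast
  have eq: "m' - m = n - n'" using n'(2) by (simp add: algebra_simps)
  have "m' - m \<in> M" "n - n' \<in> N"
    using assms m' n' by (auto simp: dsum_def intro: closed_submodule_diff)
  with eq have "m' - m \<in> M \<inter> N" by simp
  moreover have "M \<inter> N = {0}" using d by (simp add: dsum_def)
  ultimately have "m' - m = 0" by blast
  then show "m' = m" by simp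
qed

section \<open>Decompositions and surjective compressions\<close>

text \<open>Take for \<open>P\<close> the projection onto \<open>M1 + N\<close> along \<open>N2\<close>. As \<open>P\<close> kills \<open>N2\<close> and \<open>M2 + N2\<close> is everything,
  already \<open>P (T M1) = P M2\<close> is the whole range of \<open>P\<close>.\<close>

lemma compression_surjective_of_MPhi:
  assumes "T \<in> MPhi_minus_plus_hat"
  obtains P where "P \<in> Pa" "(\<lambda>x. P (T x)) ` op_range P = op_range P"
proof -
  obtain M1 N1 M2 N2 N where M2: "dsum hmod M2 N2"
    and iso: "module_iso M1 M2 T" and fg: "finitely_generated N2"
    and M1: "dsum (msum M1 N) M1 N" and M: "dsum hmod (msum M1 N) N2"
    and Pba: "proj_along (msum M1 N) N2 \<in> Ba" and T: "T \<in> Ba"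
    using assms unfolding MPhi_minus_plus_hat_def by blast
  define P where "P = proj_along (msum M1 N) N2"
  define R where "R = msum M1 N"
  have cR: "closed_submodule R" and cN2: "closed_submodule N2" and cN: "closed_submodule N"
    using M M1 by (simp_all add: dsum_def R_def)
  have P: "P (m + n) = m" if "m \<in> R" "n \<in> N2" for m n
    using proj_along_eq[OF M] that by (simp add: P_def R_def)
  have z: "0 \<in> R" "0 \<in> N2" "0 \<in> N" using cR cN2 cN
    by (simp_all add: closed_submodule_def)
  have PR: "P m = m" if "m \<in> R" for m using P[OF that z(2)] by simp
  have PN: "P n = 0" if "n \<in> N2" for n using P[OF z(1) that] by simp
  have split: "\<exists>m\<in>R. \<exists>n\<in>N2. x = m + n" if "x \<in> hmod" for x
  proof -
    have "hmod = msum R N2" using M by (simp add: dsum_def R_def)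
    then show ?thesis using that unfolding msum_def by blast
  qed
  have range: "op_range P = R"
    unfolding op_range_def
  proof
    show "P ` hmod \<subseteq> R" using split P by fastforce
    show "R \<subseteq> P ` hmod" using PR closed_submodule_hmod[OF cR] by (metis image_eqI subsetI)
  qed
  have "op_kernel P = N2"
    unfolding op_kernel_def
  proof
    show "{x \<in> hmod. P x = 0} \<subseteq> N2" using split P by fastforce
    show "N2 \<subseteq> {x \<in> hmod. P x = 0}" using PN closed_submodule_hmod[OF cN2] by blast
  qed
  moreover have "P (P x) = P x" if "x \<in> hmod" for x
    using that range PR by (auto simp: op_range_def)
  ultimately have "P \<in> Pa" using Pba fg by (simp add: Pa_def P_def)
  moreover have "(\<lambda>x. P (T x)) ` R = R"
  proof
    show "(\<lambda>x. P (T x)) ` R \<subseteq> R"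
      using module_map_in_hmod[OF Ba_bounded_module_map[OF T] closed_submodule_hmod[OF cR]] range
      by (auto simp: op_range_def)
    show "R \<subseteq> (\<lambda>x. P (T x)) ` R"
    proof
      fix u assume u: "u \<in> R"
      then have "u \<in> msum M2 N2" using closed_submodule_hmod[OF cR] M2 by (simp add: dsum_def)
      then obtain t n where t: "t \<in> M2" "n \<in> N2" "u = t + n" by (auto simp: msum_def)
      then obtain m where m: "m \<in> M1" "t = T m" using iso
        by (auto simp: module_iso_def bij_betw_def)
      have "m + 0 \<in> msum M1 N" using m(1) z(3) unfolding msum_def by blast
      then have mR: "m \<in> R" by (simp add: R_def)
      have th: "t \<in> hmod" "n \<in> hmod"
        using t M2 cN2 closed_submodule_hmod by (auto simp: dsum_def)
      have "P u = P t + P n"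
        unfolding t(3) using Pba th
          by (intro module_map_add Ba_bounded_module_map) (simp_all add: P_def)
      then have "u = P (T m)" using PR[OF u] PN[OF t(2)] m(2) by simp
      then show "u \<in> (\<lambda>x. P (T x)) ` R" using mR by blast
    qed
  qed
  ultimately show ?thesis using that range by simp
qed

text \<open>Let \<open>M\<close> be the range of \<open>P\<close>. The operator \<open>S = P T P + (1 - P)\<close> is surjective, and a bounded right
  inverse \<open>R\<close> of \<open>S\<close> maps \<open>M\<close> into itself and satisfies \<open>P T R = 1\<close> on \<open>M\<close>. Therefore \<open>R P T\<close> and \<open>T R P\<close> are bounded
  idempotents, the first with range \<open>R M\<close> and kernel \<open>ker (P T)\<close>, the second with range \<open>T R M\<close> and
  kernel \<open>ker P\<close>. They are the two decompositions required: \<open>T\<close> maps \<open>R M\<close> isomorphically onto \<open>T R M\<close>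
  with inverse \<open>R P\<close>, and maps \<open>ker (P T)\<close> into \<open>ker P\<close>. The third submodule is \<open>N = M \<inter> ker (P T)\<close>,
  since \<open>R P T\<close> leaves \<open>M\<close> invariant and splits it as \<open>R M + N\<close>; then \<open>R M + N = M\<close>, and the projection onto
  it along \<open>ker P\<close> is \<open>P\<close>, which is adjointable.\<close>

lemma MPhi_of_compression_surjective:
  fixes T P :: "(nat \<Rightarrow> 'a::unital_cstar_algebra) \<Rightarrow> nat \<Rightarrow> 'a"
  assumes T: "T \<in> Ba" and PPa: "P \<in> Pa"
    and surj: "(\<lambda>x. P (T x)) ` op_range P = op_range P"
  shows "T \<in> MPhi_minus_plus_hat"
proof -
  have PBa: "P \<in> Ba" and idem: "\<And>x. x \<in> hmod \<Longrightarrow> P (P x) = P x"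
    and fg: "finitely_generated (op_kernel P)"
    using PPa by (auto simp: Pa_def)
  have TM: "bounded_module_map T" and PM: "bounded_module_map P"
    using T PBa by (simp_all add: Ba_bounded_module_map)
  note [simp] = module_map_in_hmod[OF TM] module_map_in_hmod[OF PM]
  define S where "S = (\<lambda>x. P (T (P x)) + (x - P x))"
  have S: "S \<in> Ba"
    unfolding S_def by (intro Ba_add Ba_diff Ba_id PBa Ba_compose[OF PBa] Ba_compose[OF T])
  have PS: "P (S x) = P (T (P x))" if "x \<in> hmod" for x
    using that by (simp add: S_def module_map_add[OF PM] module_map_diff[OF PM] hmod_diff idem)
  have "S ` hmod = hmod"
  proof
    show "S ` hmod \<subseteq> hmod" by (auto simp: S_def intro!: hmod_add hmod_diff)
    show "hmod \<subseteq> S ` hmod"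
    proof
      fix y :: "nat \<Rightarrow> 'a" assume y: "y \<in> hmod"
      then have "P y \<in> (\<lambda>x. P (T x)) ` op_range P" unfolding surj
        by (simp add: op_range_def)
      then obtain m where m: "m \<in> hmod" "P y = P (T (P m))" by (auto simp: op_range_def)
      \<comment> \<open>correct the component in the range of \<open>P\<close>, keep the one in the kernel\<close>
      define x where "x = P m + (y - P y)"
      have x: "x \<in> hmod" using m y by (simp add: x_def hmod_add hmod_diff)
      have "P x = P m"
        using m(1) y
          by (simp add: x_def module_map_add[OF PM] module_map_diff[OF PM] hmod_diff idem)
      then have "S x = y" using m(2) by (simp add: S_def) (simp add: x_def)
      then show "y \<in> S ` hmod" using x by blast
    qed
  qed
  then obtain R where R: "bounded_module_map R"
    and SR: "\<And>y. y \<in> hmod \<Longrightarrow> S (R y) = y"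
    using surjective_right_inverse[OF S] by blast
  note [simp] = module_map_in_hmod[OF R]
  have PRP: "P (R (P x)) = R (P x)" if x: "x \<in> hmod" for x
  proof -
    \<comment> \<open>applying \<open>P\<close> to \<open>S (R (P x)) = P x\<close> and subtracting leaves \<open>(1 - P) (R (P x)) = 0\<close>\<close>
    have "P (T (P (R (P x)))) = P x"
      using PS[of "R (P x)"] SR[of "P x"] x by (simp add: idem)
    moreover have "S (R (P x)) = P x" using SR x by simp
    ultimately show ?thesis by (simp add: S_def)
  qed
  have PTRP: "P (T (R (P x))) = P x" if x: "x \<in> hmod" for x
    using PS[of "R (P x)"] SR[of "P x"] x by (simp add: idem PRP)
  define M1 where "M1 = {x \<in> hmod. R (P (T x)) = x}"
  define N1 where "N1 = {x \<in> hmod. P (T x) = 0}"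
  define M2 where "M2 = {x \<in> hmod. T (R (P x)) = x}"
  define N2 where "N2 = {x \<in> hmod. P x = 0}"
  define M where "M = {x \<in> hmod. P x = x}"
  define N where "N = M \<inter> N1"
  have closed: "closed_submodule M1" "closed_submodule N1" "closed_submodule M2"
      "closed_submodule N2" "closed_submodule M"
    unfolding M1_def N1_def M2_def N2_def M_def
    using bounded_module_map_compose[OF R bounded_module_map_compose[OF PM TM]]
      bounded_module_map_compose[OF PM TM]
      bounded_module_map_compose[OF TM bounded_module_map_compose[OF R PM]]
    by (auto intro!: closed_submodule_equalizer simp: bounded_module_map_zero bounded_module_map_id PM)
  then have cN: "closed_submodule N" by (simp add: N_def closed_submodule_Int)
  have M1M: "M1 \<subseteq> M"
    using PRP by (auto simp: M1_def M_def) (metis module_map_in_hmod[OF TM])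
  have split1: "R (P (T x)) \<in> M1" "x - R (P (T x)) \<in> N1" if "x \<in> hmod" for x
    using that
      by (simp_all add: M1_def N1_def PTRP module_map_diff[OF TM] module_map_diff[OF PM] hmod_diff)
  have M1N1: "M1 \<inter> N1 = {0}"
    by (auto simp: M1_def N1_def hmod_zero module_map_zero[OF R] module_map_zero[OF TM] module_map_zero[OF PM])
  have d1: "dsum hmod M1 N1"
    unfolding dsum_def msum_def
  proof (intro conjI closed M1N1 subset_antisym subsetI)
    show "x \<in> {m + n |m n. m \<in> M1 \<and> n \<in> N1}" if "x \<in> hmod" for x
    proof -
      have "x = R (P (T x)) + (x - R (P (T x)))" by simp
      then show ?thesis using split1[OF that] by blast
    qed
  qed (auto simp: M1_def N1_def hmod_add)
  have d2: "dsum hmod M2 N2"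
    unfolding dsum_def msum_def
  proof (intro conjI closed subset_antisym subsetI)
    show "x \<in> {m + n |m n. m \<in> M2 \<and> n \<in> N2}" if "x \<in> hmod" for x
    proof -
      have "x = T (R (P x)) + (x - T (R (P x)))" by simp
      moreover have "T (R (P x)) \<in> M2" "x - T (R (P x)) \<in> N2"
        using that by (simp_all add: M2_def N2_def PTRP module_map_diff[OF PM] hmod_diff)
      ultimately show ?thesis by blast
    qed
  qed (auto simp: M2_def N2_def hmod_add hmod_zero module_map_zero[OF R] module_map_zero[OF TM] module_map_zero[OF PM])
  have range: "msum M1 N = M"
  proof
    show "msum M1 N \<subseteq> M"
      using M1M closed(5) by (auto simp: msum_def N_def closed_submodule_def)
    show "M \<subseteq> msum M1 N"
    proof
      fix x assume x: "x \<in> M"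
      then have xh: "x \<in> hmod" by (simp add: M_def)
      have "x - R (P (T x)) \<in> N"
        unfolding N_def using split1[OF xh] M1M x
          by (auto intro: closed_submodule_diff[OF closed(5)])
      moreover have "x = R (P (T x)) + (x - R (P (T x)))" by simp
      ultimately show "x \<in> msum M1 N" unfolding msum_def using split1(1)[OF xh] by blast
    qed
  qed
  have d3: "dsum (msum M1 N) M1 N"
    unfolding dsum_def using closed(1) cN M1N1 M1M by (auto simp: N_def closed_submodule_def)
  have splitP: "P x \<in> M" "x - P x \<in> N2" if "x \<in> hmod" for x
    using that by (simp_all add: M_def N2_def idem module_map_diff[OF PM] hmod_diff)
  have d4: "dsum hmod M N2"
    unfolding dsum_def msum_def
  proof (intro conjI closed subset_antisym subsetI)
    show "x \<in> {m + n |m n. m \<in> M \<and> n \<in> N2}" if "x \<in> hmod" for x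
    proof -
      have "x = P x + (x - P x)" by simp
      then show ?thesis using splitP[OF that] by blast
    qed
  qed (auto simp: M_def N2_def hmod_add hmod_zero module_map_zero[OF PM])
  have proj: "proj_along M N2 \<in> Ba"
  proof (rule Ba_cong[OF PBa])
    show "proj_along M N2 x = P x" if "x \<in> hmod" for x
      using proj_along_eq[OF d4 splitP[OF that]] by simp
  qed
  have TM1: "T ` M1 \<subseteq> M2" by (auto simp: M1_def M2_def)
  have RM2: "(\<lambda>x. R (P x)) ` M2 \<subseteq> M1" by (auto simp: M1_def M2_def)
  have bij: "bij_betw T M1 M2"
    by (rule bij_betw_byWitness[OF _ _ TM1 RM2]) (auto simp: M1_def M2_def)
  have inv: "inv_into M1 T y = R (P y)" if y: "y \<in> M2" for y
    using bij y RM2 by (intro inv_into_f_eq) (auto simp: bij_betw_def M2_def)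
  have iso: "module_iso M1 M2 T"
    unfolding module_iso_def
  proof (intro conjI bij)
    show "module_linear_on M1 T"
      by (auto simp: module_linear_on_def M1_def module_map_add[OF TM] module_map_ract[OF TM])
    obtain C where "\<And>x. x \<in> hmod \<Longrightarrow> hnorm (T x) \<le> C * hnorm x"
      using module_map_bound[OF TM] by blast
    then show "bounded_on M1 T" unfolding bounded_on_def M1_def by blast
    obtain C where "\<And>x. x \<in> hmod \<Longrightarrow> hnorm (R (P x)) \<le> C * hnorm x"
      using module_map_bound[OF bounded_module_map_compose[OF R PM]] by blast
    then have "\<forall>y\<in>M2. hnorm (inv_into M1 T y) \<le> C * hnorm y"
      using inv by (simp add: M2_def)
    then show "bounded_on M2 (inv_into M1 T)" unfolding bounded_on_def by blast
  qed
  have "T ` N1 \<subseteq> N2" by (auto simp: N1_def N2_def)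
  moreover have "finitely_generated N2" using fg by (simp add: N2_def op_kernel_def)
  ultimately show ?thesis
    unfolding MPhi_minus_plus_hat_def mem_Collect_eq
    using T d1 d2 TM1 iso d3 d4 proj range by metis
qed

text \<open>Because of the identity the intersection over \<open>Pa\<close> is not over an empty family, and so stays
  inside the center.\<close>

lemma id_in_Pa: "(\<lambda>x. x) \<in> Pa"
proof -
  have "op_kernel (\<lambda>x. x) = {0 :: nat \<Rightarrow> 'a}"
    by (auto simp: op_kernel_def hmod_zero)
  moreover have "finitely_generated {0 :: nat \<Rightarrow> 'a}"
    unfolding finitely_generated_def by (intro exI[of _ "{}"]) auto
  ultimately show ?thesis by (simp add: Pa_def Ba_id)
qed

text \<open>Module linearity gives \<open>P (x \<odot> \<alpha>) = x \<odot> \<alpha>\<close> for \<open>x\<close> in the range of \<open>P\<close>, so \<open>P D - \<alpha>\<close> and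
  \<open>P (D - \<alpha>)\<close> agree there.\<close>

lemma sigma_d_compression:
  assumes D: "D \<in> Ba" and P: "P \<in> Pa" and \<alpha>: "\<alpha> \<in> center"
  shows "\<alpha> \<in> sigma_d (op_range P) (P \<circ> D) \<longleftrightarrow>
    (\<lambda>x. P (D x - x \<odot> \<alpha>)) ` op_range P \<noteq> op_range P"
proof -
  have PM: "bounded_module_map P" and idem: "\<And>x. x \<in> hmod \<Longrightarrow> P (P x) = P x"
    using P by (auto simp: Pa_def Ba_bounded_module_map)
  note DM = Ba_bounded_module_map[OF D]
  have "(\<lambda>x. (P \<circ> D) x - x \<odot> \<alpha>) ` op_range P = (\<lambda>x. P (D x - x \<odot> \<alpha>)) ` op_range P"
  proof (rule image_cong[OF refl])
    fix x assume "x \<in> op_range P"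
    then have x: "x \<in> hmod" "P x = x" using idem module_map_in_hmod[OF PM]
      by (auto simp: op_range_def)
    then show "(P \<circ> D) x - x \<odot> \<alpha> = P (D x - x \<odot> \<alpha>)"
      by (simp add: module_map_diff[OF PM] module_map_ract[OF PM] hmod_ract module_map_in_hmod[OF DM])
  qed
  then show ?thesis using \<alpha> by (simp add: sigma_d_def)
qed

theorem theorem3p8:
  fixes D :: "(nat \<Rightarrow> 'a::unital_cstar_algebra) \<Rightarrow> nat \<Rightarrow> 'a"
  assumes "D \<in> Ba"
  shows "sigma_ed_tilde D = \<Inter> {sigma_d (op_range P) (P \<circ> D) | P. P \<in> Pa}"
proof (intro set_eqI)
  fix \<alpha> :: 'a
  show "\<alpha> \<in> sigma_ed_tilde D \<longleftrightarrow> \<alpha> \<in> \<Inter> {sigma_d (op_range P) (P \<circ> D) | P. P \<in> Pa}"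
  proof (cases "\<alpha> \<in> center")
    case False
    then have "\<alpha> \<notin> sigma_d (op_range (\<lambda>x. x)) ((\<lambda>x. x) \<circ> D)"
      by (simp add: sigma_d_def)
    then have "\<alpha> \<notin> \<Inter> {sigma_d (op_range P) (P \<circ> D) | P. P \<in> Pa}"
      using id_in_Pa by blast
    then show ?thesis using False by (simp add: sigma_ed_tilde_def)
  next
    case True
    define T where "T = (\<lambda>x. D x - x \<odot> \<alpha>)"
    have T: "T \<in> Ba" unfolding T_def by (rule Ba_diff_ract_central[OF assms True])
    have "\<alpha> \<in> sigma_ed_tilde D \<longleftrightarrow> T \<notin> MPhi_minus_plus_hat"
      using True by (simp add: sigma_ed_tilde_def T_def)
    also have "\<dots> \<longleftrightarrow> (\<forall>P\<in>Pa. (\<lambda>x. P (T x)) ` op_range P \<noteq> op_range P)"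
      using MPhi_of_compression_surjective[OF T] compression_surjective_of_MPhi by metis
    also have "\<dots> \<longleftrightarrow> (\<forall>P\<in>Pa. \<alpha> \<in> sigma_d (op_range P) (P \<circ> D))"
      using sigma_d_compression[OF assms _ True] by (simp add: T_def)
    also have "\<dots> \<longleftrightarrow> \<alpha> \<in> \<Inter> {sigma_d (op_range P) (P \<circ> D) | P. P \<in> Pa}"
      by blast
    finally show ?thesis .
  qed
qed

end
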